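(* Let $f(\mathbf{x})=\mathbb{E}_\xi[f(\mathbf{x};\xi)]$ on $\mathbb{R}^d$ satisfy assumptions (i)--(iv) of the context with constants $L_1,L_2,\Delta,G$ and initial point $\mathbf{x}_0$. Let $\epsilon_1,\epsilon_2>0$, $\delta\in(0,1)$, and suppose that $\epsilon_3\le \epsilon_2/24$ and $\epsilon_4\le \min\left(\frac{1}{2\sqrt2}\epsilon_1,\ \frac{\epsilon_2^2}{24L_2}\right)$. Consider the algorithms SNCG-1 (where $\epsilon_2=\epsilon_1^\alpha$ with $\alpha\in(0,1]$) and SNCG-2 defined in the context. Then: (1) With probability at least $1-\delta$, SNCG-1 terminates with at most $$1+\max\left(\frac{48L_2^2}{\epsilon_2^3},\frac{8L_1}{\epsilon_1^2}\right)\Delta$$ NCG-S steps, and each NCG-S step (at iterate $\mathbf{x}_j$) requires time in the order of $$\widetilde O\left(T_h|\mathcal S_2| + T_h|\mathcal S_2|^{3/4}\frac{\sqrt{L_1}}{\max(\epsilon_2,\|\mathbf{g}(\mathbf{x}_j)\|^\alpha)^{1/2}}+|\mathcal S_1|T_g\right).$$ (2) With probability at least $1-\delta$, SNCG-2 terminates with at most $\frac{8L_1}{\epsilon_1^2}\Delta$ SG steps and at most $1+\frac{48L_2^2}{\epsilon_2^3}\Delta$ NCG-S steps, and each NCG-S step requires time in the order of $$\widetilde O\left(T_h|\mathcal S_2| + T_h|\mathcal S_2|^{3/4}\frac{\sqrt{L_1}}{\epsilon_2^{1/2}}+|\mathcal S_1|T_g\right).$$ (3) Upon termination, for each of the two algorithms,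 with probability at least $1-3\delta$ the returned solution $\mathbf{x}_{j_*}$ satisfies $$\|\nabla f(\mathbf{x}_{j_*})\|\le 2\epsilon_1\quad\text{and}\quad \lambda_{\min}\left(\nabla^2 f(\mathbf{x}_{j_*})\right)\ge -2\epsilon_2.$$
   Context: **Assumptions.** $\|\cdot\|$ is the Euclidean norm, $\|\cdot\|_2$ the spectral norm, $\lambda_{\min}$ the smallest eigenvalue. The problem is $\min_{\mathbf{x}\in\mathbb{R}^d} f(\mathbf{x})=\mathbb{E}_\xi[f(\mathbf{x};\xi)]$, not necessarily convex. (i) Every random function $f(\cdot;\xi)$ is twice differentiable and $\|\nabla f(\mathbf{x};\xi)-\nabla f(\mathbf{y};\xi)\|\le L_1\|\mathbf{x}-\mathbf{y}\|$ for all $\mathbf{x},\mathbf{y}$, where $L_1>0$. (ii) $f$ has Lipschitz continuous Hessian: $\|\nabla^2 f(\mathbf{x})-\nabla^2 f(\mathbf{y})\|_2\le L_2\|\mathbf{x}-\mathbf{y}\|$ for all $\mathbf{x},\mathbf{y}$, where $L_2>0$. (iii) For the given initial point $\mathbf{x}_0$ there is $\Delta<\infty$ with $f(\mathbf{x}_0)-f(\mathbf{x}_* )\le\Delta$, where $\mathbf{x}_*$ is a global minimizer of $f$. (iv) There is $G>0$ with $\mathbb{E}[\exp(\|\nabla f(\mathbf{x};\xi)-\nabla f(\mathbf{x})\|/G)]\le \exp(1)$ for all $\mathbf{x}$. **Costs.** $T_g$ is the time to compute $\nabla f(\mathbf{x};\xi)$; $T_h$ is the time to compute a product $\nabla^2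 f(\mathbf{x};\xi)\mathbf{v}$. $\widetilde O$ suppresses logarithmic factors in $d$, the inverse failure probability, and the inverse accuracy. **Stochastic gradient and Hessian.** Set $\delta'=\delta\big/\left(1+\max\left(\frac{48L_2^2}{\epsilon_2^3},\frac{8L_1}{\epsilon_1^2}\right)\Delta\right)$. At a point $\mathbf{x}$, using fresh independent i.i.d. samples $\mathcal S_1,\mathcal S_2$ of $\xi$, put $\mathbf{g}(\mathbf{x})=\frac1{|\mathcal S_1|}\sum_{\xi_i\in\mathcal S_1}\nabla f(\mathbf{x};\xi_i)$ and $H(\mathbf{x})=\frac1{|\mathcal S_2|}\sum_{\xi_i'\in\mathcal S_2}\nabla^2 f(\mathbf{x};\xi_i')$. The batch sizes satisfy $|\mathcal S_1|\ge \frac{4G^2(1+3\log^2(1/\delta'))}{\epsilon_4^2}$ and $|\mathcal S_2|\ge\frac{16L_1^2}{\epsilon_3^2}\log\frac{2d}{\delta'}$ and are large enough that, at each iteration and conditionally on the past, the event $\{\|\mathbf{g}(\mathbf{x}_j)-\nabla f(\mathbf{x}_j)\|\le\epsilon_4\}\cap\{\|H(\mathbf{x}_j)-\nabla^2 f(\mathbf{x}_j)\|_2\le\epsilon_3\}$ has probability at least $1-\delta'$ (only the gradient part being relevant when no Hessian is formed). **Approximate negative curvature.** Given $H=\frac1m\sum_{i=1}^m H_i$ with $\|H_i\|_2\le L_1$ and $\varepsilon>0$, a randomized approximate PCA routine is used that returns a unit vector $\mathbf{v}$ which, with probability at least $1-\delta'$, satisfies $\lambda_{\min}(H)\ge\mathbf{v}^\top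 H\mathbf{v}-\varepsilon$, in time $\widetilde O(T_h\max\{m,m^{3/4}\sqrt{L_1/\varepsilon}\})$. **NCG-S step**, $(\mathbf{x}^+,\mathbf{v}^\top H(\mathbf{x})\mathbf{v})=\text{NCG-S}(\mathbf{x},\varepsilon,\delta',\epsilon_1,\epsilon_2)$: form the mini-batch stochastic gradient $\mathbf{g}(\mathbf{x})=\frac1{|\mathcal S_1|}\sum_{\xi_i\in\mathcal S_1}\nabla f(\mathbf{x};\xi_i)$ and the mini-batch stochastic Hessian $H(\mathbf{x})=\frac1{|\mathcal S_2|}\sum_{\xi_i'\in\mathcal S_2}\nabla^2 f(\mathbf{x};\xi_i')$ from fresh independent i.i.d. samples $\mathcal S_1,\mathcal S_2$ of $\xi$, with batch sizes satisfying $|\mathcal S_1|\ge \frac{4G^2(1+3\log^2(1/\delta'))}{\epsilon_4^2}$ and $|\mathcal S_2|\ge\frac{16L_1^2}{\epsilon_3^2}\log\frac{2d}{\delta'}$ and large enough that, conditionally on the past, $\|\mathbf{g}(\mathbf{x})-\nabla f(\mathbf{x})\|\le\epsilon_4$ and $\|H(\mathbf{x})-\nabla^2 f(\mathbf{x})\|_2\le\epsilon_3$ hold jointly with probability at least $1-\delta'$, and apply the approximate PCA routine to $H(\mathbf{x})$ with accuracy $\varepsilon$ to get the unit vector $\mathbf{v}$. If $-\frac{\epsilon_2^2}{2L_2^2}\mathbf{v}^\top H(\mathbf{x})\mathbf{v}-\frac{11\epsilon_2^3}{48L_2^2}>\frac{\|\mathbf{g}(\mathbf{x})\|^2}{4L_1}-\frac{\epsilon_1^2}{8L_1}$,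 set $\mathbf{x}^+=\mathbf{x}-\frac{\epsilon_2}{L_2}\mathrm{sign}(\mathbf{v}^\top\mathbf{g}(\mathbf{x}))\mathbf{v}$; otherwise set $\mathbf{x}^+=\mathbf{x}-\frac1{L_1}\mathbf{g}(\mathbf{x})$. Here $\mathrm{sign}$ takes values in $\{-1,+1\}$ (e.g. $\mathrm{sign}(0)=1$). **SNCG-1**$(\mathbf{x}_0,\epsilon_1,\alpha,\delta)$, with $\alpha\in(0,1]$: set $\mathbf{x}_1=\mathbf{x}_0$, $\epsilon_2=\epsilon_1^\alpha$. For $j=1,2,\dots$: compute $(\mathbf{x}_{j+1},\mathbf{v}_j^\top H(\mathbf{x}_j)\mathbf{v}_j)=\text{NCG-S}(\mathbf{x}_j,\max(\epsilon_2,\|\mathbf{g}(\mathbf{x}_j)\|^\alpha)/2,\delta',\epsilon_1,\epsilon_2)$; if $\mathbf{v}_j^\top H(\mathbf{x}_j)\mathbf{v}_j>-\epsilon_2/2$ and $\|\mathbf{g}(\mathbf{x}_j)\|\le\epsilon_1$, return $\mathbf{x}_j$ and stop. **SNCG-2**$(\mathbf{x}_0,\epsilon_1,\delta)$ (with parameter $\epsilon_2>0$): set $\mathbf{x}_1=\mathbf{x}_0$. For $j=1,2,\dots$: compute $\mathbf{g}(\mathbf{x}_j)$; if $\|\mathbf{g}(\mathbf{x}_j)\|\ge\epsilon_1$, set $\mathbf{x}_{j+1}=\mathbf{x}_j-\frac1{L_1}\mathbf{g}(\mathbf{x}_j)$ (an "SG step"); otherwise compute $(\mathbf{x}_{j+1},\mathbf{v}_j^\top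 H(\mathbf{x}_j)\mathbf{v}_j)=\text{NCG-S}(\mathbf{x}_j,\epsilon_2/2,\delta',\epsilon_1,\epsilon_2)$ (using the same $\mathbf{g}(\mathbf{x}_j)$), and if $\mathbf{v}_j^\top H(\mathbf{x}_j)\mathbf{v}_j>-\epsilon_2/2$, return $\mathbf{x}_j$ and stop. In both algorithms $j_*$ denotes the iteration at which the algorithm stops. *)

theory Defs
  imports "HOL-Probability.Probability"
begin

definition gradient :: "(real^'n \<Rightarrow> real) \<Rightarrow> real^'n \<Rightarrow> real^'n" where
  "gradient f x = (THE D. GDERIV f x :> D)"

definition hessian :: "(real^'n \<Rightarrow> real) \<Rightarrow> real^'n \<Rightarrow> real^'n^'n" where
  "hessian f x = jacobian (gradient f) (at x)"

definition twice_differentiable :: "(real^'n \<Rightarrow> real) \<Rightarrow> bool" where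
  "twice_differentiable f \<longleftrightarrow>
     (\<forall>x. f differentiable (at x) \<and> gradient f differentiable (at x))"

definition spectral_norm :: "real^'n^'n \<Rightarrow> real" where
  "spectral_norm A = onorm ((*v) A)"

text \<open>Only meaningful for symmetric matrices, whose set of real eigenvalues is finite and nonempty.\<close>

definition lambda_min :: "real^'n^'n \<Rightarrow> real" where
  "lambda_min A = Min {l. \<exists>v. v \<noteq> 0 \<and> A *v v = l *\<^sub>R v}"

definition avg :: "'v::real_vector list \<Rightarrow> 'v" where
  "avg xs = (1 / real (length xs)) *\<^sub>R sum_list xs"

text \<open>The choice at \<open>0\<close> differs from that of \<^const>\<open>sgn\<close>: the value is always \<open>1\<close> or \<open>-1\<close>.\<close>

definition sign_pm :: "real \<Rightarrow> real" where
  "sign_pm t = (if t \<ge> 0 then 1 else - 1)"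

text \<open>
  The factor suppressed by soft-O notation, up to a power: dimension \<open>d\<close>, failure probability
  \<open>\<eta>\<close>, accuracy \<open>\<epsilon>\<close>.  It uses \<open>ln (1 + 1/\<epsilon>)\<close> rather than \<open>ln (1/\<epsilon>)\<close> so that it is at least \<open>1\<close>
  also for \<open>\<epsilon> > 1\<close>.
\<close>

definition log_factor :: "nat \<Rightarrow> real \<Rightarrow> real \<Rightarrow> real" where
  "log_factor d \<eta> \<epsilon> = 1 + ln (real d) + ln (1 / \<eta>) + ln (1 + 1 / \<epsilon>)"

text \<open>
  The cost \<open>T\<close> is in soft-O of \<open>B\<close>, with hidden constant \<open>C\<close> and hidden power \<open>k\<close>.  Keeping them
  explicit makes uniformity in all problem parameters visible, including the dimension, which is a
  type and hence cannot be quantified over inside a formula.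
\<close>

definition soft_O_bound ::
  "real \<Rightarrow> nat \<Rightarrow> nat \<Rightarrow> real \<Rightarrow> real \<Rightarrow> real \<Rightarrow> real \<Rightarrow> bool" where
  "soft_O_bound C k d \<eta> \<epsilon> T B \<longleftrightarrow> T \<le> C * log_factor d \<eta> \<epsilon> ^ k * B"

text \<open>
  A randomized routine is a function of its input (the summands of the averaged matrix, and the
  accuracy) and of a random seed with law \<open>R\<close>.  It has failure probability \<open>\<eta>\<close> on every input whose
  summands are symmetric with spectral norm at most \<open>L\<close>.  The constants \<open>C\<close> and \<open>k\<close> are those hidden
  in the soft-O bound on the running time; \<open>T\<^sub>h\<close> is the cost of one product of a summand with a
  vector.
\<close>

definition approx_pca ::
  "'s measure \<Rightarrow> real \<Rightarrow> real \<Rightarrow> real \<Rightarrow> real \<Rightarrow> nat \<Rightarrow>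
   ((real^'n^'n) list \<Rightarrow> real \<Rightarrow> 's \<Rightarrow> real^'n) \<Rightarrow> ((real^'n^'n) list \<Rightarrow> real \<Rightarrow> 's \<Rightarrow> real) \<Rightarrow> bool" where
  "approx_pca R L \<eta> T\<^sub>h C k pca pca_time \<longleftrightarrow>
     (\<forall>m>0. (\<lambda>(Hs, \<epsilon>, u). pca (map Hs [0..<m]) \<epsilon> u)
        \<in> borel_measurable ((\<Pi>\<^sub>M i\<in>{..<m}. borel) \<Otimes>\<^sub>M (borel \<Otimes>\<^sub>M R))) \<and>
     (\<forall>Hs \<epsilon>. Hs \<noteq> [] \<and> (\<forall>A\<in>set Hs. transpose A = A \<and> spectral_norm A \<le> L) \<and> \<epsilon> > 0 \<longrightarrow>
        (\<forall>u\<in>space R. norm (pca Hs \<epsilon> u) = 1) \<and>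
        measure R {u \<in> space R.
          lambda_min (avg Hs) \<ge> pca Hs \<epsilon> u \<bullet> (avg Hs *v pca Hs \<epsilon> u) - \<epsilon>} \<ge> 1 - \<eta> \<and>
        (\<forall>u\<in>space R. soft_O_bound C k CARD('n) \<eta> \<epsilon> (pca_time Hs \<epsilon> u)
           (T\<^sub>h * max (real (length Hs)) (real (length Hs) powr (3/4) * sqrt (L / \<epsilon>)))))"

text \<open>
  One iteration consumes a triple: two i.i.d. sequences of samples with law \<open>D\<close>, from which the
  gradient and the Hessian mini-batch are drawn, and a seed for the PCA routine, all independent.
  Iterations use independent triples; iteration \<open>j\<close> uses coordinate \<open>j\<close>.
\<close>

type_synonym ('a, 's) fresh = "(nat \<Rightarrow> 'a) \<times> (nat \<Rightarrow> 'a) \<times> 's"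

definition fresh_space :: "'a measure \<Rightarrow> 's measure \<Rightarrow> ('a, 's) fresh measure" where
  "fresh_space D R = (\<Pi>\<^sub>M i\<in>(UNIV::nat set). D) \<Otimes>\<^sub>M ((\<Pi>\<^sub>M i\<in>(UNIV::nat set). D) \<Otimes>\<^sub>M R)"

definition run_space :: "'a measure \<Rightarrow> 's measure \<Rightarrow> (nat \<Rightarrow> ('a, 's) fresh) measure" where
  "run_space D R = (\<Pi>\<^sub>M j\<in>(UNIV::nat set). fresh_space D R)"

text \<open>The mini-batch sizes may vary with the iteration.\<close>

record ('a, 's, 'n) sncg =
  loss :: "real^'n \<Rightarrow> 'a \<Rightarrow> real"
  size1 :: "nat \<Rightarrow> nat"
  size2 :: "nat \<Rightarrow> nat"
  routine :: "(real^'n^'n) list \<Rightarrow> real \<Rightarrow> 's \<Rightarrow> real^'n"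
  Lip1 :: real
  Lip2 :: real
  eps1 :: real
  eps2 :: real
  start :: "real^'n"

definition stoch_grad :: "('a, 's, 'n::finite) sncg \<Rightarrow> nat \<Rightarrow> real^'n \<Rightarrow> ('a, 's) fresh \<Rightarrow> real^'n" where
  "stoch_grad A j x z = avg (map (\<lambda>i. gradient (\<lambda>y. loss A y (fst z i)) x) [0..<size1 A j])"

definition hess_batch :: "('a, 's, 'n::finite) sncg \<Rightarrow> nat \<Rightarrow> real^'n \<Rightarrow> ('a, 's) fresh \<Rightarrow> (real^'n^'n) list" where
  "hess_batch A j x z = map (\<lambda>i. hessian (\<lambda>y. loss A y (fst (snd z) i)) x) [0..<size2 A j]"

definition stoch_hess :: "('a, 's, 'n::finite) sncg \<Rightarrow> nat \<Rightarrow> real^'n \<Rightarrow> ('a, 's) fresh \<Rightarrow> real^'n^'n" where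
  "stoch_hess A j x z = avg (hess_batch A j x z)"

definition ncg_s :: "('a, 's, 'n::finite) sncg \<Rightarrow> nat \<Rightarrow> real^'n \<Rightarrow> real \<Rightarrow> ('a, 's) fresh \<Rightarrow> (real^'n) \<times> real" where
  "ncg_s A j x \<epsilon> z =
     (let g = stoch_grad A j x z;
          H = stoch_hess A j x z;
          v = routine A (hess_batch A j x z) \<epsilon> (snd (snd z))
      in (if - ((eps2 A)\<^sup>2 / (2 * (Lip2 A)\<^sup>2)) * (v \<bullet> (H *v v)) - 11 * eps2 A ^ 3 / (48 * (Lip2 A)\<^sup>2)
             > (norm g)\<^sup>2 / (4 * Lip1 A) - (eps1 A)\<^sup>2 / (8 * Lip1 A)
          then x - (eps2 A / Lip2 A * sign_pm (v \<bullet> g)) *\<^sub>R v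
          else x - (1 / Lip1 A) *\<^sub>R g,
          v \<bullet> (H *v v)))"

text \<open>
  Cost of an NCG-S step: the sampled gradients, the PCA routine, and one Hessian-vector product per
  sampled Hessian for evaluating the curvature along the returned direction.
\<close>

definition ncg_s_time ::
  "real \<Rightarrow> real \<Rightarrow> ((real^'n^'n) list \<Rightarrow> real \<Rightarrow> 's \<Rightarrow> real) \<Rightarrow>
   ('a, 's, 'n::finite) sncg \<Rightarrow> nat \<Rightarrow> real^'n \<Rightarrow> real \<Rightarrow> ('a, 's) fresh \<Rightarrow> real" where
  "ncg_s_time T\<^sub>g T\<^sub>h pca_time A j x \<epsilon> z =
     real (size1 A j) * T\<^sub>g + pca_time (hess_batch A j x z) \<epsilon> (snd (snd z)) + real (size2 A j) * T\<^sub>h"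

definition acc1 :: "('a, 's, 'n::finite) sncg \<Rightarrow> real \<Rightarrow> nat \<Rightarrow> real^'n \<Rightarrow> ('a, 's) fresh \<Rightarrow> real" where
  "acc1 A \<alpha> j x z = max (eps2 A) (norm (stoch_grad A j x z) powr \<alpha>) / 2"

text \<open>
  The iterates are numbered from \<open>1\<close>, with index \<open>0\<close> denoting the given initial point.  The recursions
  do not stop by themselves; only the iterates up to the first stopping iteration belong to a run.
\<close>

primrec sncg1_iter ::
  "('a, 's, 'n::finite) sncg \<Rightarrow> real \<Rightarrow> (nat \<Rightarrow> ('a, 's) fresh) \<Rightarrow> nat \<Rightarrow> real^'n" where
  "sncg1_iter A \<alpha> \<omega> 0 = start A"
| "sncg1_iter A \<alpha> \<omega> (Suc j) =
     (let x = sncg1_iter A \<alpha> \<omega> j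
      in if j = 0 then x else fst (ncg_s A j x (acc1 A \<alpha> j x (\<omega> j)) (\<omega> j)))"

definition sncg1_stops ::
  "('a, 's, 'n::finite) sncg \<Rightarrow> real \<Rightarrow> (nat \<Rightarrow> ('a, 's) fresh) \<Rightarrow> nat \<Rightarrow> bool" where
  "sncg1_stops A \<alpha> \<omega> j \<longleftrightarrow>
     (let x = sncg1_iter A \<alpha> \<omega> j
      in snd (ncg_s A j x (acc1 A \<alpha> j x (\<omega> j)) (\<omega> j)) > - eps2 A / 2 \<and>
         norm (stoch_grad A j x (\<omega> j)) \<le> eps1 A)"

definition sg_cond :: "('a, 's, 'n::finite) sncg \<Rightarrow> nat \<Rightarrow> real^'n \<Rightarrow> ('a, 's) fresh \<Rightarrow> bool" where
  "sg_cond A j x z \<longleftrightarrow> norm (stoch_grad A j x z) \<ge> eps1 A"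

primrec sncg2_iter ::
  "('a, 's, 'n::finite) sncg \<Rightarrow> (nat \<Rightarrow> ('a, 's) fresh) \<Rightarrow> nat \<Rightarrow> real^'n" where
  "sncg2_iter A \<omega> 0 = start A"
| "sncg2_iter A \<omega> (Suc j) =
     (let x = sncg2_iter A \<omega> j
      in if j = 0 then x
         else if sg_cond A j x (\<omega> j) then x - (1 / Lip1 A) *\<^sub>R stoch_grad A j x (\<omega> j)
         else fst (ncg_s A j x (eps2 A / 2) (\<omega> j)))"

definition sncg2_stops :: "('a, 's, 'n::finite) sncg \<Rightarrow> (nat \<Rightarrow> ('a, 's) fresh) \<Rightarrow> nat \<Rightarrow> bool" where
  "sncg2_stops A \<omega> j \<longleftrightarrow>
     (let x = sncg2_iter A \<omega> j
      in \<not> sg_cond A j x (\<omega> j) \<and> snd (ncg_s A j x (eps2 A / 2) (\<omega> j)) > - eps2 A / 2)"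

definition terminates :: "(nat \<Rightarrow> bool) \<Rightarrow> bool" where
  "terminates stops \<longleftrightarrow> (\<exists>j\<ge>1. stops j)"

definition stop_index :: "(nat \<Rightarrow> bool) \<Rightarrow> nat" where
  "stop_index stops = (LEAST j. j \<ge> 1 \<and> stops j)"

definition executed :: "(nat \<Rightarrow> bool) \<Rightarrow> nat \<Rightarrow> bool" where
  "executed stops j \<longleftrightarrow> j \<ge> 1 \<and> (\<forall>i. 1 \<le> i \<and> i < j \<longrightarrow> \<not> stops i)"

definition sncg1_ncg_steps ::
  "('a, 's, 'n::finite) sncg \<Rightarrow> real \<Rightarrow> (nat \<Rightarrow> ('a, 's) fresh) \<Rightarrow> nat set" where
  "sncg1_ncg_steps A \<alpha> \<omega> = {j. executed (sncg1_stops A \<alpha> \<omega>) j}"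

definition sncg2_sg_steps ::
  "('a, 's, 'n::finite) sncg \<Rightarrow> (nat \<Rightarrow> ('a, 's) fresh) \<Rightarrow> nat set" where
  "sncg2_sg_steps A \<omega> =
     {j. executed (sncg2_stops A \<omega>) j \<and> sg_cond A j (sncg2_iter A \<omega> j) (\<omega> j)}"

definition sncg2_ncg_steps ::
  "('a, 's, 'n::finite) sncg \<Rightarrow> (nat \<Rightarrow> ('a, 's) fresh) \<Rightarrow> nat set" where
  "sncg2_ncg_steps A \<omega> =
     {j. executed (sncg2_stops A \<omega>) j \<and> \<not> sg_cond A j (sncg2_iter A \<omega> j) (\<omega> j)}"

end

theory Submission
  imports Defs
begin

text \<open>
  If the sampled gradient and Hessian are accurate at an iterate, a gradient step decreases \<open>f\<close> by at
  least \<open>\<parallel>g\<parallel>\<^sup>2 / 4L\<^sub>1 - \<epsilon>\<^sub>1\<^sup>2 / 8L\<^sub>1\<close> and a negative curvature step by at least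
  \<open>- (\<epsilon>\<^sub>2\<^sup>2 / 2L\<^sub>2\<^sup>2) v\<^sup>THv - 11\<epsilon>\<^sub>2\<^sup>3 / 48L\<^sub>2\<^sup>2\<close>: the two sides of the test in NCG-S, so that its step realises the
  larger guarantee.  As long as the algorithm does not stop, one of these is at least \<open>\<epsilon>\<^sub>1\<^sup>2 / 8L\<^sub>1\<close> or
  \<open>\<epsilon>\<^sub>2\<^sup>3 / 48L\<^sub>2\<^sup>2\<close>, and the total decrease is at most \<open>\<Delta>\<close>.  Hence accuracy is needed only during the
  first \<open>\<lfloor>1 + K\<Delta>\<rfloor>\<close> iterations, \<open>K = max (48L\<^sub>2\<^sup>2 / \<epsilon>\<^sub>2\<^sup>3) (8L\<^sub>1 / \<epsilon>\<^sub>1\<^sup>2)\<close>, and a union bound costs \<open>\<delta>\<close>;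
  success of the PCA routine in the same iterations, needed only for the eigenvalue bound at the
  returned point, costs another \<open>\<delta>\<close>.

  All events must be shown measurable.  This rests on the joint measurability of the sampled
  gradients and Hessians in the point and the sample, and on the characterisation of \<^const>\<open>lambda_min\<close>
  by the Rayleigh quotient; the latter needs symmetric Hessians, hence Schwarz's theorem for functions that are
  merely twice differentiable.
\<close>

subsection \<open>Gradients and Hessians\<close>

lemma GDERIV_unique:
  assumes "GDERIV f x :> D" "GDERIV f x :> E"
  shows "D = E"
proof -
  have "(\<lambda>h. h \<bullet> D) = (\<lambda>h. h \<bullet> E)"
    using assms has_derivative_unique unfolding gderiv_def by blast
  then show ?thesis
    by (metis inner_commute vector_eq_rdot)
qed

text \<open>Riesz representation of the derivative: its values on the orthonormal basis are the
  coordinates of the gradient. Together with uniqueness this makes the definite description in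
  \<open>gradient\<close> meaningful.\<close>

lemma differentiable_GDERIV:
  fixes f :: "real^'n \<Rightarrow> real"
  assumes "f differentiable (at x)"
  shows "GDERIV f x :> gradient f x"
proof -
  obtain f' where f': "(f has_derivative f') (at x)"
    using assms unfolding differentiable_def by blast
  then interpret bounded_linear f'
    by (rule has_derivative_bounded_linear)
  have "f' h = h \<bullet> (\<Sum>b\<in>Basis. f' b *\<^sub>R b)" for h
  proof -
    have "f' h = f' (\<Sum>b\<in>Basis. (h \<bullet> b) *\<^sub>R b)"
      by (simp add: euclidean_representation)
    also have "\<dots> = (\<Sum>b\<in>Basis. (h \<bullet> b) *\<^sub>R f' b)"
      by (simp add: sum scale)
    also have "\<dots> = h \<bullet> (\<Sum>b\<in>Basis. f' b *\<^sub>R b)"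
      by (simp add: inner_sum_right mult.commute)
    finally show ?thesis .
  qed
  then have "GDERIV f x :> (\<Sum>b\<in>Basis. f' b *\<^sub>R b)"
    using f' unfolding gderiv_def by (metis (no_types, lifting) ext)
  then show ?thesis
    unfolding gradient_def by (rule theI) (blast intro: GDERIV_unique \<open>GDERIV f x :> _\<close>)
qed

lemma has_real_derivative_along_line:
  fixes f :: "real^'n \<Rightarrow> real"
  assumes "\<And>y. f differentiable (at y)"
  shows "((\<lambda>t. f (x + t *\<^sub>R v)) has_real_derivative v \<bullet> gradient f (x + t *\<^sub>R v)) (at t within S)"
proof -
  have "(f has_derivative (\<lambda>h. h \<bullet> gradient f (x + t *\<^sub>R v))) (at (x + t *\<^sub>R v))"
    using differentiable_GDERIV assms gderiv_def by blast
  moreover have "((\<lambda>t. x + t *\<^sub>R v) has_derivative (\<lambda>s. s *\<^sub>R v)) (at t within S)"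
    by (auto intro!: derivative_eq_intros)
  ultimately have "((\<lambda>t. f (x + t *\<^sub>R v)) has_derivative (\<lambda>s. (s *\<^sub>R v) \<bullet> gradient f (x + t *\<^sub>R v))) (at t within S)"
    by (rule has_derivative_compose[rotated])
  then show ?thesis
    by (simp add: has_field_derivative_def mult.commute[of _ "v \<bullet> _"])
qed

lemma hessian_works:
  assumes "twice_differentiable f"
  shows "(gradient f has_derivative (\<lambda>h. hessian f x *v h)) (at x)"
  using assms unfolding twice_differentiable_def hessian_def by (simp add: jacobian_works)

section \<open>Symmetry of the Hessian under mere twice differentiability\<close>

text \<open>The mean value theorem is applied once, to the increment in direction
  \<open>t *\<^sub>R v\<close> as a function of the displacement along \<open>u\<close>. The two
  gradients that result are then expanded at \<open>x\<close> alone, so differentiability of the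
  gradient at that single point suffices. Their two remainders give the factor 2 in the
  error.\<close>

lemma second_difference_bound:
  fixes f :: "real^'n \<Rightarrow> real"
  assumes f: "\<And>y. f differentiable (at y)" and t: "t > 0"
    and bound: "\<And>h. norm h \<le> t * (norm u + norm v) \<Longrightarrow>
      norm (gradient f (x + h) - gradient f x - H *v h) \<le> e * norm h"
    and e: "e \<ge> 0"
  shows "\<bar>f (x + t *\<^sub>R u + t *\<^sub>R v) - f (x + t *\<^sub>R u) - f (x + t *\<^sub>R v) + f x - t\<^sup>2 * (u \<bullet> (H *v v))\<bar>
    \<le> 2 * e * t\<^sup>2 * (norm u + norm v)\<^sup>2"
proof -
  define \<phi> where "\<phi> s = f (x + t *\<^sub>R v + s *\<^sub>R u) - f (x + s *\<^sub>R u)" for s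
  define \<phi>' where "\<phi>' s = u \<bullet> (gradient f (x + t *\<^sub>R v + s *\<^sub>R u) - gradient f (x + s *\<^sub>R u))" for s
  have "DERIV \<phi> s :> \<phi>' s" for s
    unfolding \<phi>_def \<phi>'_def inner_diff_right
    by (intro DERIV_diff has_real_derivative_along_line f)
  then obtain s where s: "0 < s" "s < t" "\<phi> t - \<phi> 0 = t * \<phi>' s"
    using MVT2[of 0 t \<phi> \<phi>'] t by auto
  let ?N = "norm u + norm v"
  have su: "norm (s *\<^sub>R u) \<le> t * norm u" using s by (simp add: mult_right_mono)
  have tv: "norm (t *\<^sub>R v) = t * norm v" using t by simp
  let ?r = "\<lambda>h. gradient f (x + h) - gradient f x - H *v h"
  have n1: "norm (t *\<^sub>R v + s *\<^sub>R u) \<le> t * ?N"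
    using norm_triangle_ineq[of "t *\<^sub>R v" "s *\<^sub>R u"] su tv by (simp only: distrib_left)
  have n2: "norm (s *\<^sub>R u) \<le> t * ?N"
    using su t by (smt (verit, best) mult_left_mono norm_ge_zero)
  have r1: "norm (?r (t *\<^sub>R v + s *\<^sub>R u)) \<le> e * (t * ?N)"
    using bound[OF n1] mult_left_mono[OF n1 e] by linarith
  have r2: "norm (?r (s *\<^sub>R u)) \<le> e * (t * ?N)"
    using bound[OF n2] mult_left_mono[OF n2 e] by linarith
  have "\<phi>' s - t * (u \<bullet> (H *v v)) = u \<bullet> (?r (t *\<^sub>R v + s *\<^sub>R u) - ?r (s *\<^sub>R u))"
    unfolding \<phi>'_def
    by (simp add: inner_diff_right inner_add_right matrix_vector_right_distrib add.assoc
        matrix_vector_mult_scaleR)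
  also have "\<bar>\<dots>\<bar> \<le> norm u * (2 * (e * (t * ?N)))"
    using Cauchy_Schwarz_ineq2[of u "?r (t *\<^sub>R v + s *\<^sub>R u) - ?r (s *\<^sub>R u)"]
      norm_triangle_ineq4[of "?r (t *\<^sub>R v + s *\<^sub>R u)" "?r (s *\<^sub>R u)"] r1 r2
    by (smt (verit, best) mult_left_mono norm_ge_zero)
  also have "\<dots> \<le> ?N * (2 * (e * (t * ?N)))"
    using e t by (intro mult_right_mono) auto
  finally have "\<bar>t * (\<phi>' s - t * (u \<bullet> (H *v v)))\<bar> \<le> t * (?N * (2 * (e * (t * ?N))))"
    using t by (simp add: abs_mult)
  moreover have "f (x + t *\<^sub>R u + t *\<^sub>R v) - f (x + t *\<^sub>R u) - f (x + t *\<^sub>R v) + f x = t * \<phi>' s"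
    using s(3) unfolding \<phi>_def by (simp add: algebra_simps)
  ultimately show ?thesis
    by (simp add: algebra_simps power2_eq_square)
qed

text \<open>The second difference is symmetric in \<open>u\<close> and \<open>v\<close>, and after
  division by \<open>t\<^sup>2\<close> it approximates both bilinear values up to an error
  proportional to the arbitrary \<open>e\<close>.\<close>

lemma hessian_inner_commute:
  fixes f :: "real^'n \<Rightarrow> real"
  assumes f: "twice_differentiable f"
  shows "u \<bullet> (hessian f x *v v) = v \<bullet> (hessian f x *v u)"
proof -
  let ?H = "hessian f x"
  let ?N = "norm u + norm v"
  have "\<bar>u \<bullet> (?H *v v) - v \<bullet> (?H *v u)\<bar> \<le> c" if "c > 0" for c
  proof -
    \<comment> \<open>The factor 4 adds the errors of the two second differences; the summand 1
      keeps the denominator positive when \<open>u\<close> and \<open>v\<close> both vanish.\<close>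
    define e where "e = c / (4 * ?N\<^sup>2 + 1)"
    have e: "e > 0" unfolding e_def using that by (intro divide_pos_pos) (auto simp: add_nonneg_pos)
    obtain d where d: "d > 0"
      "\<And>y. norm (y - x) < d \<Longrightarrow> norm (gradient f y - gradient f x - ?H *v (y - x)) \<le> e * norm (y - x)"
      using hessian_works[OF f, of x] e unfolding has_derivative_at_alt by blast
    define t where "t = d / (?N + 1)"
    have "?N + 1 > 0" by (simp add: add_nonneg_pos)
    then have t: "t > 0" "t * ?N < d"
      using d(1) by (auto simp: t_def pos_divide_less_eq)
    have bound: "norm (gradient f (x + h) - gradient f x - ?H *v h) \<le> e * norm h"
      if "norm h \<le> t * ?N" for h
      using d(2)[of "x + h"] that t by simp
    have fd: "\<And>y. f differentiable (at y)"
      using f unfolding twice_differentiable_def by blast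
    have bound': "norm (gradient f (x + h) - gradient f x - ?H *v h) \<le> e * norm h"
      if "norm h \<le> t * (norm v + norm u)" for h
      using bound that by (simp add: add.commute)
    note B1 = second_difference_bound[of f t u v x ?H e, OF fd t(1) bound less_imp_le[OF e]]
    note B2 = second_difference_bound[of f t v u x ?H e, OF fd t(1) bound' less_imp_le[OF e]]
    have "t\<^sup>2 * \<bar>u \<bullet> (?H *v v) - v \<bullet> (?H *v u)\<bar>
      = \<bar>t\<^sup>2 * (u \<bullet> (?H *v v)) - t\<^sup>2 * (v \<bullet> (?H *v u))\<bar>"
      by (simp add: abs_mult flip: right_diff_distrib)
    also have "\<dots> \<le> 4 * e * t\<^sup>2 * ?N\<^sup>2"
      using B1 B2
      by (simp add: add.commute[of "norm v"] add.assoc add.commute[of "t *\<^sub>R v"])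
    finally have "\<bar>u \<bullet> (?H *v v) - v \<bullet> (?H *v u)\<bar> \<le> 4 * e * ?N\<^sup>2"
      using t(1) by (simp add: algebra_simps)
    also have "\<dots> \<le> e * (4 * ?N\<^sup>2 + 1)" using e by (simp add: algebra_simps)
    also have "\<dots> = c" unfolding e_def
      by (simp add: add_nonneg_pos order_less_imp_not_eq2)
    finally show ?thesis .
  qed
  then show ?thesis
    by (metis abs_ge_zero dense_le_bounded eq_iff_diff_eq_0 field_le_epsilon abs_le_zero_iff add_0)
qed

lemma transpose_eq_iff_inner:
  fixes A :: "real^'n^'n"
  shows "transpose A = A \<longleftrightarrow> (\<forall>u v. u \<bullet> (A *v v) = v \<bullet> (A *v u))"
proof
  assume "transpose A = A"
  then show "\<forall>u v. u \<bullet> (A *v v) = v \<bullet> (A *v u)"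
    by (metis dot_lmul_matrix inner_commute transpose_matrix_vector)
next
  assume *: "\<forall>u v. u \<bullet> (A *v v) = v \<bullet> (A *v u)"
  have "A $ i $ j = A $ j $ i" for i j
    using *[rule_format, of "axis i 1" "axis j 1"]
    by (simp add: inner_axis' matrix_vector_mult_basis column_def)
  then show "transpose A = A"
    by (simp add: transpose_def vec_eq_iff)
qed

lemma transpose_hessian:
  assumes "twice_differentiable f"
  shows "transpose (hessian f x) = hessian f x"
  using hessian_inner_commute[OF assms] by (simp add: transpose_eq_iff_inner)

text \<open>The derivative as a limit along a sequence, not along a real parameter: pointwise limits
  of sequences preserve measurability as well as inequalities, and it is used for both.\<close>

lemma has_derivative_difference_quotient:
  fixes f :: "'a::real_normed_vector \<Rightarrow> 'b::real_normed_vector"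
  assumes "(f has_derivative f') (at x)"
  shows "(\<lambda>n. real (Suc n) *\<^sub>R (f (x + (1 / real (Suc n)) *\<^sub>R v) - f x)) \<longlonglongrightarrow> f' v"
proof -
  interpret bounded_linear f' using assms by (rule has_derivative_bounded_linear)
  have "((\<lambda>t. x + t *\<^sub>R v) has_derivative (\<lambda>s. s *\<^sub>R v)) (at (0::real))"
    by (auto intro!: derivative_eq_intros)
  then have "((\<lambda>t. f (x + t *\<^sub>R v)) has_derivative (\<lambda>s. f' (s *\<^sub>R v))) (at (0::real))"
    using has_derivative_compose[of "\<lambda>t. x + t *\<^sub>R v" _ 0 UNIV f f'] assms by simp
  then have lim: "((\<lambda>t. (1 / norm (t - 0)) *\<^sub>R (f (x + t *\<^sub>R v) - (f (x + 0 *\<^sub>R v) + f' ((t - 0) *\<^sub>R v)))) \<longlongrightarrow> 0) (at (0::real))"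
    unfolding has_derivative_at2 by blast
  have "filterlim (\<lambda>n. 1 / real (Suc n)) (at 0) sequentially"
    unfolding filterlim_at using lim_1_over_n[THEN LIMSEQ_Suc] by simp
  from filterlim_compose[OF lim this]
  have "(\<lambda>n. real (Suc n) *\<^sub>R (f (x + (1 / real (Suc n)) *\<^sub>R v) - f x) - f' v) \<longlonglongrightarrow> 0"
    by (simp add: algebra_simps scale scaleR_diff_right del: of_nat_Suc)
  then show ?thesis
    by (rule Lim_transform2[OF tendsto_const, rotated] | simp add: LIM_zero_iff)+
qed

section \<open>Spectral norm and smallest eigenvalue\<close>

lemma spectral_norm_le_iff: "spectral_norm A \<le> c \<longleftrightarrow> (\<forall>v. norm (A *v v) \<le> c * norm v)"
proof
  assume "spectral_norm A \<le> c"
  then show "\<forall>v. norm (A *v v) \<le> c * norm v"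
    unfolding spectral_norm_def
    by (meson dual_order.trans matrix_vector_mul_bounded_linear mult_right_mono norm_ge_zero onorm)
next
  assume "\<forall>v. norm (A *v v) \<le> c * norm v"
  then show "spectral_norm A \<le> c"
    unfolding spectral_norm_def by (intro onorm_le) auto
qed

lemma spectral_norm_quadratic_form:
  assumes "spectral_norm A \<le> c" "norm v = 1"
  shows "\<bar>v \<bullet> (A *v v)\<bar> \<le> c"
  using Cauchy_Schwarz_ineq2[of v "A *v v"] assms by (auto simp: spectral_norm_le_iff dest!: spec[of _ v])

text \<open>The Lipschitz condition bounds every difference quotient of the gradient by
  \<open>L * norm v\<close>, and the bound survives the limit.\<close>

lemma spectral_norm_hessian_le:
  assumes "twice_differentiable f"
    and lip: "\<And>x y. norm (gradient f x - gradient f y) \<le> L * norm (x - y)"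
  shows "spectral_norm (hessian f x) \<le> L"
proof -
  have "norm (hessian f x *v v) \<le> L * norm v" for v
  proof (rule LIMSEQ_le_const2)
    show "(\<lambda>n. norm (real (Suc n) *\<^sub>R (gradient f (x + (1 / real (Suc n)) *\<^sub>R v) - gradient f x)))
        \<longlonglongrightarrow> norm (hessian f x *v v)"
      by (intro tendsto_norm has_derivative_difference_quotient hessian_works assms)
    have "norm (real (Suc n) *\<^sub>R (gradient f (x + (1 / real (Suc n)) *\<^sub>R v) - gradient f x)) \<le> L * norm v" for n
      using lip[of "x + (1 / real (Suc n)) *\<^sub>R v" x]
      by (simp add: pos_le_divide_eq mult.commute del: of_nat_Suc)
    then show "\<exists>N. \<forall>n\<ge>N. norm (real (Suc n) *\<^sub>R (gradient f (x + (1 / real (Suc n)) *\<^sub>R v) - gradient f x)) \<le> L * norm v"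
      by blast
  qed
  then show ?thesis by (simp add: spectral_norm_le_iff)
qed

text \<open>Eigenvectors for distinct eigenvalues are orthogonal, and a pairwise orthogonal set in
  finite dimension is finite. This is what gives the \<open>Min\<close> in \<open>lambda_min\<close>
  its intended value.\<close>

lemma finite_eigenvalues_symmetric:
  fixes A :: "real^'n^'n"
  assumes "transpose A = A"
  shows "finite {l. \<exists>v. v \<noteq> 0 \<and> A *v v = l *\<^sub>R v}" (is "finite ?E")
proof -
  have sym: "u \<bullet> (A *v v) = v \<bullet> (A *v u)" for u v
    using assms by (simp add: transpose_eq_iff_inner)
  have "\<forall>l\<in>?E. \<exists>v. v \<noteq> 0 \<and> A *v v = l *\<^sub>R v"
    by blast
  then obtain w where "\<forall>l\<in>?E. w l \<noteq> 0 \<and> A *v w l = l *\<^sub>R w l"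
    by (rule bchoice[THEN exE])
  then have w: "\<And>l. l \<in> ?E \<Longrightarrow> w l \<noteq> 0 \<and> A *v w l = l *\<^sub>R w l"
    by blast
  have orth: "w l \<bullet> w m = 0" if "l \<in> ?E" "m \<in> ?E" "l \<noteq> m" for l m
    using sym[of "w l" "w m"] w[OF that(1)] w[OF that(2)] that(3) by (simp add: inner_commute)
  have "inj_on w ?E"
  proof (rule inj_onI, rule ccontr)
    fix l m assume "l \<in> ?E" "m \<in> ?E" "w l = w m" "l \<noteq> m"
    then show False using orth[of l m] w[of l] by (simp del: mem_Collect_eq)
  qed
  moreover have "finite (w ` ?E)"
  proof (rule pairwise_orthogonal_imp_finite, rule pairwiseI)
    fix a b assume "a \<in> w ` ?E" "b \<in> w ` ?E" "a \<noteq> b"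
    then show "orthogonal a b"
      unfolding orthogonal_def using orth by blast
  qed
  ultimately show ?thesis by (rule finite_imageD[rotated])
qed

text \<open>Perturb \<open>v\<close> along the residual \<open>r\<close> of the eigenvalue equation.
  The quadratic form shifted by its minimum stays nonnegative, but its first-order term in
  \<open>t\<close> is \<open>2 * t * (r \<bullet> r)\<close>, so a small negative \<open>t\<close>
  forces \<open>r\<close> to vanish.\<close>

lemma rayleigh_minimizer_eigenvector:
  fixes A :: "real^'n^'n"
  assumes sym: "transpose A = A" and v: "norm v = 1"
    and min: "\<And>w. norm w = 1 \<Longrightarrow> v \<bullet> (A *v v) \<le> w \<bullet> (A *v w)"
  shows "A *v v = (v \<bullet> (A *v v)) *\<^sub>R v"
proof -
  let ?m = "v \<bullet> (A *v v)"
  have hom: "?m * (w \<bullet> w) \<le> w \<bullet> (A *v w)" for w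
  proof (cases "w = 0")
    case False
    have "?m \<le> ((1 / norm w) *\<^sub>R w) \<bullet> (A *v ((1 / norm w) *\<^sub>R w))"
      using False by (intro min) simp
    also have "\<dots> = (w \<bullet> (A *v w)) / (w \<bullet> w)"
      by (simp add: matrix_vector_mult_scaleR dot_square_norm power2_eq_square)
    finally show ?thesis using False by (simp add: pos_le_divide_eq)
  qed simp
  define r where "r = A *v v - ?m *\<^sub>R v"
  let ?q = "r \<bullet> (A *v r) - ?m * (r \<bullet> r)"
  have quad: "0 \<le> 2 * t * (r \<bullet> r) + t\<^sup>2 * ?q" for t
  proof -
    have "v \<bullet> (A *v r) = r \<bullet> (A *v v)"
      using sym by (simp add: transpose_eq_iff_inner)
    then have "(v + t *\<^sub>R r) \<bullet> (A *v (v + t *\<^sub>R r)) - ?m * ((v + t *\<^sub>R r) \<bullet> (v + t *\<^sub>R r))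
      = ?m - ?m * (v \<bullet> v) + 2 * t * (r \<bullet> (A *v v) - ?m * (r \<bullet> v)) + t\<^sup>2 * ?q"
      by (simp add: inner_add_left inner_add_right matrix_vector_right_distrib
          matrix_vector_mult_scaleR inner_commute[of v r] power2_eq_square algebra_simps)
    also have "r \<bullet> (A *v v) - ?m * (r \<bullet> v) = r \<bullet> r"
      by (simp add: r_def inner_diff_right)
    also have "?m - ?m * (v \<bullet> v) = 0"
      using v by (simp add: dot_square_norm)
    finally show ?thesis using hom[of "v + t *\<^sub>R r"] by linarith
  qed
  have "r \<bullet> r = 0"
  proof (rule ccontr)
    assume "r \<bullet> r \<noteq> 0"
    then have pos: "r \<bullet> r > 0" by simp
    have "0 \<le> ?q" using hom[of r] by simp
    \<comment> \<open>Up to the summand 1, this minimises the quadratic in \<open>quad\<close>; the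
      summand covers the case where \<open>?q\<close> is 0.\<close>
    define t where "t = - (r \<bullet> r) / (?q + 1)"
    have "t * (?q + 1) = - (r \<bullet> r)" using \<open>0 \<le> ?q\<close> by (simp add: t_def)
    then have "t\<^sup>2 * ?q = - t * (r \<bullet> r) - t\<^sup>2"
      by (simp add: power2_eq_square algebra_simps)
        (metis (no_types, opaque_lifting) distrib_left mult.left_commute mult_minus_right)
    then have "0 \<le> t * (r \<bullet> r) - t\<^sup>2" using quad[of t] by simp
    moreover have "t < 0" using pos \<open>0 \<le> ?q\<close> by (simp add: t_def divide_neg_pos)
    ultimately show False using pos
      by (smt (verit) mult_neg_pos zero_le_power2)
  qed
  then show ?thesis by (simp add: r_def)
qed

text \<open>The quadratic form attains its minimum on the compact unit sphere. The minimiser is an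
  eigenvector, and every eigenvalue is the value of the form at a unit eigenvector, so the minimum
  is the smallest eigenvalue. In this form lower bounds are closed conditions on the matrix and are
  easily transferred to nearby matrices.\<close>

lemma le_lambda_min_iff:
  fixes A :: "real^'n^'n"
  assumes sym: "transpose A = A"
  shows "c \<le> lambda_min A \<longleftrightarrow> (\<forall>w. norm w = 1 \<longrightarrow> c \<le> w \<bullet> (A *v w))"
proof -
  let ?E = "{l. \<exists>v. v \<noteq> 0 \<and> A *v v = l *\<^sub>R v}"
  have "compact (sphere (0::real^'n) 1)" "sphere (0::real^'n) 1 \<noteq> {}"
    by (auto simp: sphere_eq_empty)
  moreover have "continuous_on (sphere 0 1) (\<lambda>v. v \<bullet> (A *v v))"
    by (intro continuous_intros matrix_vector_mult_linear_continuous_on)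
  ultimately obtain v where v: "norm v = 1" "\<And>w. norm w = 1 \<Longrightarrow> v \<bullet> (A *v v) \<le> w \<bullet> (A *v w)"
    using continuous_attains_inf[of "sphere (0::real^'n) 1" "\<lambda>v. v \<bullet> (A *v v)"]
    by (auto simp: dist_norm)
  have lower: "v \<bullet> (A *v v) \<le> l" if l: "l \<in> ?E" for l
  proof -
    obtain w where w: "w \<noteq> 0" "A *v w = l *\<^sub>R w" using l by blast
    let ?u = "(1 / norm w) *\<^sub>R w"
    have "v \<bullet> (A *v v) \<le> ?u \<bullet> (A *v ?u)" using w by (intro v) simp
    also have "\<dots> = l"
      using w by (simp add: matrix_vector_mult_scaleR dot_square_norm power2_eq_square)
    finally show ?thesis .
  qed
  have "v \<bullet> (A *v v) \<in> ?E"
    using rayleigh_minimizer_eigenvector[OF sym v] v(1) by (metis (mono_tags, lifting) mem_Collect_eq norm_zero zero_neq_one)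
  then have "lambda_min A = v \<bullet> (A *v v)"
    unfolding lambda_min_def using lower by (intro Min_eqI finite_eigenvalues_symmetric sym) auto
  then show ?thesis using v by (metis order_trans)
qed

section \<open>Taylor bounds from Lipschitz derivatives\<close>

text \<open>Two monotonicity arguments replace integration. The Hessian bound makes
  \<open>\<psi>\<close>, the error of the directional derivative, nonincreasing from 0; as
  \<open>\<psi>\<close> is the derivative of the Taylor error \<open>\<theta>\<close>, the latter is
  nonincreasing from 0 as well.\<close>

lemma cubic_upper_bound:
  fixes f :: "real^'n \<Rightarrow> real"
  assumes f: "twice_differentiable f"
    and lip: "\<And>y. spectral_norm (hessian f y - hessian f x) \<le> L * norm (y - x)"
    and v: "norm v = 1" and t: "t \<ge> 0"
  shows "f (x + t *\<^sub>R v) \<le> f x + t * (v \<bullet> gradient f x) + t\<^sup>2 / 2 * (v \<bullet> (hessian f x *v v)) + L * t ^ 3 / 6"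
proof -
  let ?b = "v \<bullet> (hessian f x *v v)" and ?a = "v \<bullet> gradient f x"
  define \<psi> where "\<psi> s = v \<bullet> gradient f (x + s *\<^sub>R v) - ?a - s * ?b - L * s\<^sup>2 / 2" for s
  define \<theta> where "\<theta> s = f (x + s *\<^sub>R v) - f x - s * ?a - s\<^sup>2 / 2 * ?b - L * s ^ 3 / 6" for s
  have fd: "\<And>y. f differentiable (at y)"
    using f unfolding twice_differentiable_def by blast
  have d\<psi>: "DERIV \<psi> s :> v \<bullet> (hessian f (x + s *\<^sub>R v) *v v) - ?b - L * s" for s
  proof -
    have "((\<lambda>s. x + s *\<^sub>R v) has_derivative (\<lambda>s. s *\<^sub>R v)) (at s)"
      by (auto intro!: derivative_eq_intros)
    from has_derivative_compose[OF this hessian_works[OF f]]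
    have "((\<lambda>s. v \<bullet> gradient f (x + s *\<^sub>R v)) has_derivative (\<lambda>h. v \<bullet> (hessian f (x + s *\<^sub>R v) *v (h *\<^sub>R v)))) (at s)"
      by (rule has_derivative_inner_right)
    then have "DERIV (\<lambda>s. v \<bullet> gradient f (x + s *\<^sub>R v)) s :> v \<bullet> (hessian f (x + s *\<^sub>R v) *v v)"
      by (simp add: has_field_derivative_def matrix_vector_mult_scaleR mult.commute[of _ "v \<bullet> _"])
    then show ?thesis
      unfolding \<psi>_def by (auto intro!: derivative_eq_intros)
  qed
  have "\<psi> s \<le> \<psi> 0" if "s \<ge> 0" for s
  proof (rule DERIV_nonpos_imp_nonincreasing[OF that])
    fix r assume r: "0 \<le> r" "r \<le> s"
    have "\<bar>v \<bullet> ((hessian f (x + r *\<^sub>R v) - hessian f x) *v v)\<bar> \<le> L * r"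
      using lip[of "x + r *\<^sub>R v"] v r by (intro spectral_norm_quadratic_form) simp_all
    then show "\<exists>y. DERIV \<psi> r :> y \<and> y \<le> 0"
      using d\<psi>[of r] by (intro exI conjI) (auto simp: matrix_vector_mult_diff_rdistrib inner_diff_right)
  qed
  then have \<psi>: "\<psi> s \<le> 0" if "s \<ge> 0" for s
    using that by (fastforce simp: \<psi>_def)
  have "\<theta> t \<le> \<theta> 0"
  proof (rule DERIV_nonpos_imp_nonincreasing[OF t])
    fix r assume r: "0 \<le> r" "r \<le> t"
    have "DERIV \<theta> r :> v \<bullet> gradient f (x + r *\<^sub>R v) - ?a - r * ?b - L * r\<^sup>2 / 2"
      unfolding \<theta>_def
      by (auto intro!: derivative_eq_intros has_real_derivative_along_line fd simp: power2_eq_square)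
    then show "\<exists>y. DERIV \<theta> r :> y \<and> y \<le> 0"
      using \<psi>[OF r(1)] by (auto simp: \<psi>_def)
  qed
  then show ?thesis by (simp add: \<theta>_def)
qed

text \<open>Along the segment, the first-order error minus the quadratic
  \<open>L * r\<^sup>2 / 2 * (norm v)\<^sup>2\<close> is nonincreasing, and plus that quadratic it
  is nondecreasing. Both signs serve the comparison of difference quotients under the
  expectation.\<close>

lemma lipschitz_gradient_bounds:
  fixes f :: "real^'n \<Rightarrow> real"
  assumes fd: "\<And>y. f differentiable (at y)"
    and lip: "\<And>y. norm (gradient f y - gradient f x) \<le> L * norm (y - x)"
  shows "\<bar>f (x + v) - f x - v \<bullet> gradient f x\<bar> \<le> L / 2 * (norm v)\<^sup>2"
proof -
  let ?a = "v \<bullet> gradient f x"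
  have bound: "\<bar>v \<bullet> gradient f (x + r *\<^sub>R v) - ?a\<bar> \<le> L * r * (norm v)\<^sup>2" if "0 \<le> r" for r
  proof -
    have "\<bar>v \<bullet> (gradient f (x + r *\<^sub>R v) - gradient f x)\<bar> \<le> norm v * (L * norm (r *\<^sub>R v))"
      using Cauchy_Schwarz_ineq2 lip[of "x + r *\<^sub>R v"]
      by (smt (verit, best) add_diff_cancel_left' mult_left_mono norm_ge_zero)
    then show ?thesis using that by (simp add: inner_diff_right power2_eq_square mult.commute mult.left_commute)
  qed
  have "f (x + 1 *\<^sub>R v) - 1 * ?a - L * 1\<^sup>2 / 2 * (norm v)\<^sup>2 \<le> f (x + 0 *\<^sub>R v) - 0 * ?a - L * 0\<^sup>2 / 2 * (norm v)\<^sup>2"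
  proof (rule DERIV_nonpos_imp_nonincreasing[where f = "\<lambda>r. f (x + r *\<^sub>R v) - r * ?a - L * r\<^sup>2 / 2 * (norm v)\<^sup>2"])
    fix r :: real assume r: "0 \<le> r" "r \<le> 1"
    have "DERIV (\<lambda>r. f (x + r *\<^sub>R v) - r * ?a - L * r\<^sup>2 / 2 * (norm v)\<^sup>2) r :> v \<bullet> gradient f (x + r *\<^sub>R v) - ?a - L * r * (norm v)\<^sup>2"
      by (auto intro!: derivative_eq_intros has_real_derivative_along_line fd)
    then show "\<exists>y. DERIV (\<lambda>r. f (x + r *\<^sub>R v) - r * ?a - L * r\<^sup>2 / 2 * (norm v)\<^sup>2) r :> y \<and> y \<le> 0"
      using bound[OF r(1)] by (intro exI conjI) auto
  qed simp
  moreover have "f (x + 0 *\<^sub>R v) - 0 * ?a + L * 0\<^sup>2 / 2 * (norm v)\<^sup>2 \<le> f (x + 1 *\<^sub>R v) - 1 * ?a + L * 1\<^sup>2 / 2 * (norm v)\<^sup>2"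
  proof (rule DERIV_nonneg_imp_nondecreasing[where f = "\<lambda>r. f (x + r *\<^sub>R v) - r * ?a + L * r\<^sup>2 / 2 * (norm v)\<^sup>2"])
    fix r :: real assume r: "0 \<le> r" "r \<le> 1"
    have "DERIV (\<lambda>r. f (x + r *\<^sub>R v) - r * ?a + L * r\<^sup>2 / 2 * (norm v)\<^sup>2) r :> v \<bullet> gradient f (x + r *\<^sub>R v) - ?a + L * r * (norm v)\<^sup>2"
      by (auto intro!: derivative_eq_intros has_real_derivative_along_line fd)
    then show "\<exists>y. DERIV (\<lambda>r. f (x + r *\<^sub>R v) - r * ?a + L * r\<^sup>2 / 2 * (norm v)\<^sup>2) r :> y \<and> y \<ge> 0"
      using bound[OF r(1)] by (intro exI conjI) auto
  qed simp
  ultimately have "f (x + v) - f x - ?a \<le> L / 2 * (norm v)\<^sup>2" "- (f (x + v) - f x - ?a) \<le> L / 2 * (norm v)\<^sup>2"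
    by simp_all
  then show ?thesis by (rule abs_leI)
qed

text \<open>
  Exchanging gradient and expectation is avoided: the deterministic bound is integrated in the
  form that compares two difference quotients, and the smaller step is then sent to \<open>0\<close>.
\<close>

lemma expectation_quadratic_upper_bound:
  fixes F :: "real^'n \<Rightarrow> 'a \<Rightarrow> real"
  assumes D: "prob_space D" and int: "\<And>x. integrable D (F x)" and f: "\<And>x. f x = (\<integral>\<xi>. F x \<xi> \<partial>D)"
    and Fd: "\<And>\<xi> x. \<xi> \<in> space D \<Longrightarrow> (\<lambda>x. F x \<xi>) differentiable (at x)"
    and fd: "f differentiable (at x)"
    and lip: "\<And>\<xi> x y. \<xi> \<in> space D \<Longrightarrow>
         norm (gradient (\<lambda>x. F x \<xi>) x - gradient (\<lambda>x. F x \<xi>) y) \<le> L * norm (x - y)"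
  shows "f (x + v) \<le> f x + v \<bullet> gradient f x + L / 2 * (norm v)\<^sup>2"
proof -
  interpret prob_space D by (fact D)
  let ?b = "L / 2 * (norm v)\<^sup>2"
  have step: "f (x + v) - f x - real (Suc n) *\<^sub>R (f (x + (1 / real (Suc n)) *\<^sub>R v) - f x) \<le> ?b + ?b / real (Suc n)" for n
  proof -
    let ?t = "1 / real (Suc n)"
    \<comment> \<open>The upper bound for the full step is combined with the lower bound for the
      step \<open>?t\<close>. The sample derivative \<open>?d\<close> cancels, which leaves an
      inequality between functions that are integrable by \<open>int\<close>.\<close>
    have "F (x + v) \<xi> - F x \<xi> - real (Suc n) * (F (x + ?t *\<^sub>R v) \<xi> - F x \<xi>) \<le> ?b + ?b / real (Suc n)"
      if \<xi>: "\<xi> \<in> space D" for \<xi>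
    proof -
      have B: "\<bar>F (x + w) \<xi> - F x \<xi> - w \<bullet> gradient (\<lambda>x. F x \<xi>) x\<bar> \<le> L / 2 * (norm w)\<^sup>2" for w
        using Fd[OF \<xi>] lip[OF \<xi>] by (rule lipschitz_gradient_bounds)
      let ?d = "v \<bullet> gradient (\<lambda>x. F x \<xi>) x"
      have "?t * ?d - L / 2 * (?t * norm v)\<^sup>2 \<le> F (x + ?t *\<^sub>R v) \<xi> - F x \<xi>"
        using abs_le_D2[OF B[of "?t *\<^sub>R v"]]
        by (simp only: inner_scaleR_left norm_scaleR abs_of_nat abs_divide abs_one)
      then have "real (Suc n) * (?t * ?d - L / 2 * (?t * norm v)\<^sup>2) \<le> real (Suc n) * (F (x + ?t *\<^sub>R v) \<xi> - F x \<xi>)"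
        by (rule mult_left_mono) simp
      moreover have "real (Suc n) * (?t * ?d - L / 2 * (?t * norm v)\<^sup>2) = ?d - ?b / real (Suc n)"
        by (simp add: field_simps power2_eq_square del: of_nat_Suc)
      ultimately show ?thesis using B[of v] by linarith
    qed
    then have "(\<integral>\<xi>. F (x + v) \<xi> - F x \<xi> - real (Suc n) * (F (x + ?t *\<^sub>R v) \<xi> - F x \<xi>) \<partial>D)
      \<le> (\<integral>\<xi>. ?b + ?b / real (Suc n) \<partial>D)"
      by (intro integral_mono Bochner_Integration.integrable_diff integrable_mult_right int) auto
    then show ?thesis
      by (simp add: f int prob_space del: of_nat_Suc)
  qed
  have "f (x + v) - f x - v \<bullet> gradient f x \<le> ?b + 0"
  proof (rule LIMSEQ_le)
    show "(\<lambda>n. f (x + v) - f x - real (Suc n) *\<^sub>R (f (x + (1 / real (Suc n)) *\<^sub>R v) - f x))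
        \<longlonglongrightarrow> f (x + v) - f x - v \<bullet> gradient f x"
      using has_derivative_difference_quotient[OF differentiable_GDERIV[OF fd, unfolded gderiv_def], of v]
      by (intro tendsto_diff tendsto_const)
    show "(\<lambda>n. ?b + ?b / real (Suc n)) \<longlonglongrightarrow> ?b + 0"
      by (intro tendsto_add tendsto_const lim_const_over_n[THEN LIMSEQ_Suc])
    show "\<exists>N. \<forall>n\<ge>N. f (x + v) - f x - real (Suc n) *\<^sub>R (f (x + (1 / real (Suc n)) *\<^sub>R v) - f x) \<le> ?b + ?b / real (Suc n)"
      using step by blast
  qed
  then show ?thesis by simp
qed

subsection \<open>Measurability\<close>

text \<open>The identity in \<open>x\<close> is a pointwise limit of simple functions. With one of
  these inserted, the first argument runs through finitely many constants and measurability in the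
  sample is enough; continuity in \<open>x\<close> then carries measurability to the limit.\<close>

lemma borel_measurable_Caratheodory:
  fixes h :: "'x::{metric_space, second_countable_topology} \<Rightarrow> 'o \<Rightarrow> 'y::metric_space"
  assumes cont: "\<And>\<omega>. \<omega> \<in> space M \<Longrightarrow> continuous_on UNIV (\<lambda>x. h x \<omega>)"
    and meas: "\<And>x. h x \<in> borel_measurable M"
  shows "(\<lambda>(x, \<omega>). h x \<omega>) \<in> borel_measurable (borel \<Otimes>\<^sub>M M)"
proof -
  have "(\<lambda>x::'x. x) \<in> borel_measurable borel" by simp
  \<comment> \<open>The reference point occurs only in a distance estimate that is discarded, so any
    point will do.\<close>
  from borel_measurable_implies_sequence_metric[OF this, of undefined]
  obtain q :: "nat \<Rightarrow> 'x \<Rightarrow> 'x" where q: "\<And>i. simple_function borel (q i)"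
    "\<And>x. (\<lambda>i. q i x) \<longlonglongrightarrow> x"
    by auto
  show ?thesis
  proof (rule borel_measurable_LIMSEQ_metric)
    fix i
    have fin: "finite (range (q i))" using simple_functionD(1)[OF q(1)] by simp
    have "q i \<in> borel \<rightarrow>\<^sub>M count_space (range (q i))"
      using simple_functionD(2)[OF q(1), of i] by (subst measurable_count_space_eq2[OF fin]) auto
    then have "(\<lambda>p. q i (fst p)) \<in> borel \<Otimes>\<^sub>M M \<rightarrow>\<^sub>M count_space (range (q i))"
      by (rule measurable_compose[OF measurable_fst])
    moreover have "(\<lambda>p. h x (snd p)) \<in> borel_measurable (borel \<Otimes>\<^sub>M M)" for x
      using meas by measurable
    ultimately show "(\<lambda>p. h (q i (fst p)) (snd p)) \<in> borel_measurable (borel \<Otimes>\<^sub>M M)"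
      using measurable_compose_countable'[of "range (q i)" "\<lambda>x p. h x (snd p)"] countable_finite[OF fin]
      by blast
  next
    fix p :: "'x \<times> 'o" assume p: "p \<in> space (borel \<Otimes>\<^sub>M M)"
    then have "snd p \<in> space M" by (auto simp: space_pair_measure)
    then have "isCont (\<lambda>x. h x (snd p)) (fst p)"
      using cont continuous_on_eq_continuous_at[OF open_UNIV] by blast
    from isCont_tendsto_compose[OF this q(2)]
    show "(\<lambda>i. h (q i (fst p)) (snd p)) \<longlonglongrightarrow> (case p of (x, \<omega>) \<Rightarrow> h x \<omega>)"
      by (simp add: case_prod_beta)
  qed
qed

text \<open>Differentiability makes \<open>F\<close> continuous in the point, hence jointly
  measurable; each component of the gradient is a limit of difference quotients of
  \<open>F\<close>.\<close>

lemma borel_measurable_gradient: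
  fixes F :: "real^'n \<Rightarrow> 'a \<Rightarrow> real"
  assumes [measurable]: "\<And>x. F x \<in> borel_measurable D"
    and diff: "\<And>\<xi> x. \<xi> \<in> space D \<Longrightarrow> (\<lambda>x. F x \<xi>) differentiable (at x)"
  shows "(\<lambda>(x, \<xi>). gradient (\<lambda>y. F y \<xi>) x) \<in> borel_measurable (borel \<Otimes>\<^sub>M D)"
proof -
  have "(\<lambda>(x, \<xi>). F x \<xi>) \<in> borel_measurable (borel \<Otimes>\<^sub>M D)"
    using diff by (intro borel_measurable_Caratheodory assms differentiable_imp_continuous_on)
      (auto simp: differentiable_on_def)
  then have [measurable]: "(\<lambda>p. F (g p) (k p)) \<in> borel_measurable N"
    if [measurable]: "g \<in> borel_measurable N" "k \<in> N \<rightarrow>\<^sub>M D" for g k and N :: "((real^'n) \<times> 'a) measure"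
    using measurable_compose[of "\<lambda>p. (g p, k p)" N "borel \<Otimes>\<^sub>M D" "\<lambda>(x, \<xi>). F x \<xi>"] by simp
  have "(\<lambda>p. gradient (\<lambda>y. F y (snd p)) (fst p) \<bullet> b) \<in> borel_measurable (borel \<Otimes>\<^sub>M D)" for b :: "real^'n"
  proof (rule borel_measurable_LIMSEQ_real)
    fix p :: "(real^'n) \<times> 'a" assume "p \<in> space (borel \<Otimes>\<^sub>M D)"
    then have "snd p \<in> space D" by (auto simp: space_pair_measure)
    from has_derivative_difference_quotient[OF differentiable_GDERIV[OF diff[OF this], unfolded gderiv_def], of "fst p" b]
    show "(\<lambda>n. real (Suc n) *\<^sub>R (F (fst p + (1 / real (Suc n)) *\<^sub>R b) (snd p) - F (fst p) (snd p)))
        \<longlonglongrightarrow> gradient (\<lambda>y. F y (snd p)) (fst p) \<bullet> b"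
      by (simp only: inner_commute)
  qed measurable
  then show ?thesis
    by (subst borel_measurable_euclidean_space) (simp add: case_prod_beta)
qed

text \<open>The Hessian of a sample need not be continuous in the point, so it is again reached as a
  limit, now of difference quotients of the jointly measurable gradient.\<close>

lemma borel_measurable_hessian:
  fixes F :: "real^'n \<Rightarrow> 'a \<Rightarrow> real"
  assumes meas: "\<And>x. F x \<in> borel_measurable D"
    and diff: "\<And>\<xi>. \<xi> \<in> space D \<Longrightarrow> twice_differentiable (\<lambda>x. F x \<xi>)"
  shows "(\<lambda>(x, \<xi>). hessian (\<lambda>y. F y \<xi>) x) \<in> borel_measurable (borel \<Otimes>\<^sub>M D)"
proof -
  have "(\<lambda>(x, \<xi>). gradient (\<lambda>y. F y \<xi>) x) \<in> borel_measurable (borel \<Otimes>\<^sub>M D)"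
    using meas diff by (intro borel_measurable_gradient) (auto simp: twice_differentiable_def)
  then have [measurable]: "(\<lambda>p. gradient (\<lambda>y. F y (k p)) (g p)) \<in> borel_measurable N"
    if [measurable]: "g \<in> borel_measurable N" "k \<in> N \<rightarrow>\<^sub>M D" for g k and N :: "((real^'n) \<times> 'a) measure"
    using measurable_compose[of "\<lambda>p. (g p, k p)" N "borel \<Otimes>\<^sub>M D" "\<lambda>(x, \<xi>). gradient (\<lambda>y. F y \<xi>) x"] by simp
  have col: "(\<lambda>p. hessian (\<lambda>y. F y (snd p)) (fst p) *v v) \<in> borel_measurable (borel \<Otimes>\<^sub>M D)" for v
  proof (rule borel_measurable_LIMSEQ_metric)
    fix p :: "(real^'n) \<times> 'a" assume "p \<in> space (borel \<Otimes>\<^sub>M D)"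
    then have "snd p \<in> space D" by (auto simp: space_pair_measure)
    from has_derivative_difference_quotient[OF hessian_works[OF diff[OF this]], of "fst p" v]
    show "(\<lambda>n. real (Suc n) *\<^sub>R (gradient (\<lambda>y. F y (snd p)) (fst p + (1 / real (Suc n)) *\<^sub>R v) - gradient (\<lambda>y. F y (snd p)) (fst p)))
        \<longlonglongrightarrow> hessian (\<lambda>y. F y (snd p)) (fst p) *v v" .
  qed measurable
  have "(\<lambda>p. hessian (\<lambda>y. F y (snd p)) (fst p) \<bullet> b) \<in> borel_measurable (borel \<Otimes>\<^sub>M D)"
    if "b \<in> Basis" for b :: "real^'n^'n"
  proof -
    obtain i k where b: "b = axis i (axis k 1)"
      using \<open>b \<in> Basis\<close> by (auto simp: Basis_vec_def)
    \<comment> \<open>The coordinates of a matrix are its entries, and these are components of the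
      images of the unit vectors, to which \<open>col\<close> applies.\<close>
    have "A \<bullet> b = (A *v axis k 1) \<bullet> axis i 1" for A :: "real^'n^'n"
      by (simp add: b inner_axis matrix_vector_mult_basis column_def)
    then show ?thesis using col[of "axis k 1"] by simp
  qed
  then show ?thesis
    by (subst borel_measurable_euclidean_space) (simp add: case_prod_beta)
qed

section \<open>Measurable functionals of matrices\<close>

lemma bounded_bilinear_matrix_vector_mult:
  "bounded_bilinear ((*v) :: real^'n^'m \<Rightarrow> real^'n \<Rightarrow> real^'m)"
  unfolding bilinear_conv_bounded_bilinear[symmetric] bilinear_def
  by (auto intro!: linearI simp: matrix_vector_mult_add_rdistrib matrix_vector_right_distrib
      scaleR_matrix_vector_assoc matrix_vector_mult_scaleR)

lemma borel_measurable_matrix_vector_mult[measurable]: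
  fixes A :: "'a \<Rightarrow> real^'n^'m"
  assumes "A \<in> borel_measurable M" "v \<in> borel_measurable M"
  shows "(\<lambda>x. A x *v v x) \<in> borel_measurable M"
  by (rule borel_measurable_continuous_Pair[OF assms],
      rule bounded_bilinear.continuous_on[OF bounded_bilinear_matrix_vector_mult])
    (auto intro!: continuous_intros)

lemma borel_measurable_spectral_norm[measurable]: "(spectral_norm :: real^'n^'n \<Rightarrow> real) \<in> borel_measurable borel"
proof (rule borel_measurableI_le)
  fix c
  have "closed {A::real^'n^'n. \<forall>v. norm (A *v v) \<le> c * norm v}"
    by (intro closed_Collect_all closed_Collect_le continuous_intros
        bounded_bilinear.continuous_on[OF bounded_bilinear_matrix_vector_mult])
  then show "{A \<in> space borel. spectral_norm (A::real^'n^'n) \<le> c} \<in> sets borel"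
    by (simp add: spectral_norm_le_iff borel_closed)
qed

text \<open>By the Rayleigh characterisation a superlevel set is the preimage of a closed set of
  matrices. The characterisation concerns symmetric matrices, whence \<open>sym\<close>.\<close>

lemma borel_measurable_lambda_min:
  assumes [measurable]: "A \<in> borel_measurable M" and sym: "\<And>x. x \<in> space M \<Longrightarrow> transpose (A x) = A x"
  shows "(\<lambda>x. lambda_min (A x :: real^'n^'n)) \<in> borel_measurable M"
proof (rule borel_measurableI_ge)
  fix c
  have "closed {A::real^'n^'n. \<forall>w. norm w = 1 \<longrightarrow> c \<le> w \<bullet> (A *v w)}"
    by (intro closed_Collect_all closed_Collect_imp open_Collect_const closed_Collect_le continuous_intros
        bounded_bilinear.continuous_on[OF bounded_bilinear_matrix_vector_mult])
  then have [measurable]: "{A::real^'n^'n. \<forall>w. norm w = 1 \<longrightarrow> c \<le> w \<bullet> (A *v w)} \<in> sets borel"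
    by simp
  have "{x \<in> space M. A x \<in> {A. \<forall>w. norm w = 1 \<longrightarrow> c \<le> w \<bullet> (A *v w)}} \<in> sets M"
    by measurable
  moreover have "{x \<in> space M. c \<le> lambda_min (A x)} = {x \<in> space M. A x \<in> {A. \<forall>w. norm w = 1 \<longrightarrow> c \<le> w \<bullet> (A *v w)}}"
    using sym by (auto simp: le_lambda_min_iff)
  ultimately show "{x \<in> space M. c \<le> lambda_min (A x)} \<in> sets M" by simp
qed

subsection \<open>Trajectories driven by independent samples\<close>

text \<open>The common shape of both algorithms, which lets measurability and the probability bounds
  be proved once. Iterate 1 repeats the initial point, so iteration \<open>j\<close> reads
  coordinate \<open>j\<close> and iterate \<open>j\<close> depends only on smaller
  coordinates.\<close>

primrec trajectory :: "'x \<Rightarrow> (nat \<Rightarrow> 'x \<Rightarrow> 'z \<Rightarrow> 'x) \<Rightarrow> (nat \<Rightarrow> 'z) \<Rightarrow> nat \<Rightarrow> 'x" where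
  "trajectory x\<^sub>0 step \<omega> 0 = x\<^sub>0"
| "trajectory x\<^sub>0 step \<omega> (Suc j) =
     (if j = 0 then x\<^sub>0 else step j (trajectory x\<^sub>0 step \<omega> j) (\<omega> j))"

lemma trajectory_cong:
  "(\<And>i. i < j \<Longrightarrow> \<omega> i = \<omega>' i) \<Longrightarrow> trajectory x\<^sub>0 step \<omega> j = trajectory x\<^sub>0 step \<omega>' j"
  by (induction j) auto

lemma measurable_trajectory:
  assumes step: "\<And>j. j \<ge> 1 \<Longrightarrow> (\<lambda>(x, z). step j x z) \<in> N \<Otimes>\<^sub>M M \<rightarrow>\<^sub>M N"
    and x\<^sub>0: "x\<^sub>0 \<in> space N"
  shows "(\<lambda>\<omega>. trajectory x\<^sub>0 step \<omega> j) \<in> (\<Pi>\<^sub>M i\<in>(UNIV::nat set). M) \<rightarrow>\<^sub>M N"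
proof (induction j)
  case (Suc j)
  show ?case
  proof (cases "j = 0")
    case False
    have "(\<lambda>\<omega>. (trajectory x\<^sub>0 step \<omega> j, \<omega> j)) \<in> (\<Pi>\<^sub>M i\<in>(UNIV::nat set). M) \<rightarrow>\<^sub>M N \<Otimes>\<^sub>M M"
      using Suc.IH by measurable
    from measurable_compose[OF this step] False show ?thesis by simp
  qed (simp add: x\<^sub>0)
qed (simp add: x\<^sub>0)

context sequence_space
begin

text \<open>A variable that depends only on the coordinates before \<open>j\<close> is independent of coordinate \<open>j\<close>.\<close>

lemma emeasure_past_le:
  assumes X[measurable]: "X \<in> S \<rightarrow>\<^sub>M N"
    and past: "\<And>\<omega> \<omega>'. (\<And>i. i < j \<Longrightarrow> \<omega> i = \<omega>' i) \<Longrightarrow> X \<omega> = X \<omega>'"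
    and B[measurable]: "B \<in> sets (N \<Otimes>\<^sub>M M)"
    and le: "\<And>x. x \<in> space N \<Longrightarrow> emeasure M {z \<in> space M. (x, z) \<in> B} \<le> c"
  shows "emeasure S {\<omega> \<in> space S. (X \<omega>, \<omega> j) \<in> B} \<le> c"
proof -
  let ?E = "{\<omega> \<in> space S. (X \<omega>, \<omega> j) \<in> B}"
  have E[measurable]: "?E \<in> sets S" by measurable
  \<comment> \<open>Splicing: the first \<open>j\<close> coordinates come from one sequence and the
    rest from an independent copy, which leaves the law unchanged. Now \<open>X\<close> sees only
    the first sequence and coordinate \<open>j\<close> is coordinate 0 of the second, so Fubini
    reduces the claim to a fixed value of \<open>X\<close>.\<close>
  have "emeasure S ?E = emeasure (distr (S \<Otimes>\<^sub>M S) S (\<lambda>(\<omega>, \<omega>'). comb_seq j \<omega> \<omega>')) ?E"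
    by (simp add: PiM_comb_seq)
  also have "\<dots> = emeasure (S \<Otimes>\<^sub>M S) ((\<lambda>(\<omega>, \<omega>'). comb_seq j \<omega> \<omega>') -` ?E \<inter> space (S \<Otimes>\<^sub>M S))"
    by (intro emeasure_distr measurable_comb_seq E)
  also have "(\<lambda>(\<omega>, \<omega>'). comb_seq j \<omega> \<omega>') -` ?E \<inter> space (S \<Otimes>\<^sub>M S)
    = {p \<in> space (S \<Otimes>\<^sub>M S). (X (fst p), snd p 0) \<in> B}" (is "_ = ?G")
  proof -
    have "X (comb_seq j \<omega> \<omega>') = X \<omega>" for \<omega> \<omega>'
      by (rule past) (simp add: comb_seq_less)
    moreover have "comb_seq j \<omega> \<omega>' j = \<omega>' 0" for \<omega> \<omega>' :: "nat \<Rightarrow> 'a"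
      using comb_seq_add[of j \<omega> \<omega>' 0] by simp
    moreover have "comb_seq j \<omega> \<omega>' \<in> space S" if "(\<omega>, \<omega>') \<in> space (S \<Otimes>\<^sub>M S)" for \<omega> \<omega>'
      using measurable_space[OF measurable_comb_seq that] by simp
    ultimately show ?thesis by (auto simp: space_pair_measure)
  qed
  also have "emeasure (S \<Otimes>\<^sub>M S) ?G = (\<integral>\<^sup>+\<omega>. emeasure S (Pair \<omega> -` ?G) \<partial>S)"
    by (rule P.emeasure_pair_measure_alt) measurable
  also have "\<dots> \<le> (\<integral>\<^sup>+\<omega>. c \<partial>S)"
  proof (rule nn_integral_mono)
    fix \<omega> assume \<omega>: "\<omega> \<in> space S"
    then have X\<omega>: "X \<omega> \<in> space N" using measurable_space[OF X] by simp
    have "Pair \<omega> -` ?G = (\<lambda>\<omega>'. \<omega>' 0) -` {z \<in> space M. (X \<omega>, z) \<in> B} \<inter> space S"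
      using \<omega> by (auto simp: space_pair_measure space_PiM PiE_iff)
    also have "emeasure S \<dots> = emeasure (distr S M (\<lambda>\<omega>'. \<omega>' 0)) {z \<in> space M. (X \<omega>, z) \<in> B}"
      using X\<omega> by (intro emeasure_distr[symmetric]) measurable
    also have "\<dots> = emeasure M {z \<in> space M. (X \<omega>, z) \<in> B}"
      by (simp add: PiM_component)
    also have "\<dots> \<le> c" by (rule le[OF X\<omega>])
    finally show "emeasure S (Pair \<omega> -` ?G) \<le> c" .
  qed
  also have "\<dots> = c" by (simp add: P.emeasure_space_1 emeasure_space_1)
  finally show ?thesis .
qed

text \<open>The bound on \<open>good\<close> is required at every fixed point. Since iterate
  \<open>j\<close> is independent of coordinate \<open>j\<close>, it holds at the random iterate
  too, and a union bound over the first \<open>n\<close> iterations follows.\<close>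

lemma prob_trajectory_ge:
  assumes step: "\<And>j. j \<ge> 1 \<Longrightarrow> (\<lambda>(x, z). step j x z) \<in> N \<Otimes>\<^sub>M M \<rightarrow>\<^sub>M N"
    and x\<^sub>0: "x\<^sub>0 \<in> space N"
    and good[measurable]: "\<And>j. j \<ge> 1 \<Longrightarrow> good j \<in> sets (N \<Otimes>\<^sub>M M)"
    and ge: "\<And>j x. j \<ge> 1 \<Longrightarrow> x \<in> space N \<Longrightarrow> measure M {z \<in> space M. (x, z) \<in> good j} \<ge> 1 - \<eta>"
  shows "measure S {\<omega> \<in> space S. \<forall>j\<in>{1..n}. (trajectory x\<^sub>0 step \<omega> j, \<omega> j) \<in> good j} \<ge> 1 - real n * \<eta>"
proof -
  interpret M: prob_space M by (rule prob_space)
  let ?X = "trajectory x\<^sub>0 step"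
  let ?B = "\<lambda>j. {\<omega> \<in> space S. (?X \<omega> j, \<omega> j) \<in> space (N \<Otimes>\<^sub>M M) - good j}"
  let ?G = "{\<omega> \<in> space S. \<forall>j\<in>{1..n}. (?X \<omega> j, \<omega> j) \<in> good j}"
  \<comment> \<open>Needed to return from \<open>ennreal\<close>, where a negative bound would be
    truncated to 0.\<close>
  have \<eta>: "\<eta> \<ge> 0"
    using ge[of 1 x\<^sub>0] x\<^sub>0 M.prob_le_1[of "{z \<in> space M. (x\<^sub>0, z) \<in> good 1}"] by linarith
  have B: "?B j \<in> sets S" if "j \<ge> 1" for j
  proof -
    have "(\<lambda>\<omega>. (?X \<omega> j, \<omega> j)) \<in> S \<rightarrow>\<^sub>M N \<Otimes>\<^sub>M M"
      using measurable_trajectory[OF step x\<^sub>0] by (intro measurable_Pair) simp_all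
    from measurable_sets[OF this sets.compl_sets[OF good[OF that]]]
    show ?thesis by (simp add: vimage_def Int_def conj_commute)
  qed
  have "measure S (?B j) \<le> \<eta>" if j: "j \<ge> 1" for j
  proof -
    note [measurable] = good[OF j]
    have "emeasure M {z \<in> space M. (x, z) \<in> space (N \<Otimes>\<^sub>M M) - good j} \<le> ennreal \<eta>"
      if x: "x \<in> space N" for x
    proof -
      have m: "{z \<in> space M. (x, z) \<in> good j} \<in> sets M"
        using x by measurable
      have "{z \<in> space M. (x, z) \<in> space (N \<Otimes>\<^sub>M M) - good j} = space M - {z \<in> space M. (x, z) \<in> good j}"
        using x by (auto simp: space_pair_measure)
      then have "measure M {z \<in> space M. (x, z) \<in> space (N \<Otimes>\<^sub>M M) - good j} \<le> \<eta>"
        using M.prob_compl[OF m] ge[OF j x] by simp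
      then show ?thesis by (simp add: M.emeasure_eq_measure ennreal_leI)
    qed
    then have "emeasure S (?B j) \<le> ennreal \<eta>"
      by (intro emeasure_past_le[where N = N] measurable_trajectory step x\<^sub>0 trajectory_cong) auto
    then show ?thesis using \<eta> by (simp add: P.emeasure_eq_measure)
  qed
  then have "measure S (\<Union>j\<in>{1..n}. ?B j) \<le> (\<Sum>j\<in>{1..n}. \<eta>)"
    by (intro order_trans[OF P.finite_measure_subadditive_finite] sum_mono) (use B in auto)
  moreover have "?G = space S - (\<Union>j\<in>{1..n}. ?B j)"
    using measurable_space[OF measurable_trajectory[OF step x\<^sub>0]]
    by (auto simp: space_pair_measure space_PiM PiE_iff)
  moreover have "(\<Union>j\<in>{1..n}. ?B j) \<in> sets S" using B by auto
  ultimately show ?thesis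
    by (simp add: P.prob_compl)
qed

end

section \<open>Stopping indices and step counts\<close>

lemma executed_eq_atLeastAtMost:
  assumes "terminates stops"
  shows "{j. executed stops j} = {1..stop_index stops}" "stop_index stops \<ge> 1"
    "stops (stop_index stops)" "\<And>i. 1 \<le> i \<Longrightarrow> i < stop_index stops \<Longrightarrow> \<not> stops i"
proof -
  obtain j where "j \<ge> 1 \<and> stops j" using assms by (auto simp: terminates_def)
  then have J: "stop_index stops \<ge> 1 \<and> stops (stop_index stops)"
    unfolding stop_index_def by (rule LeastI)
  then show "stop_index stops \<ge> 1" "stops (stop_index stops)" by simp_all
  show before: "\<not> stops i" if "1 \<le> i" "i < stop_index stops" for i
    using that not_less_Least[of i "\<lambda>j. j \<ge> 1 \<and> stops j"] unfolding stop_index_def by blast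
  show "{j. executed stops j} = {1..stop_index stops}"
    using J before by (auto simp: executed_def dest: not_le_imp_less)
qed

lemma stop_index_le: "1 \<le> j \<Longrightarrow> stops j \<Longrightarrow> stop_index stops \<le> j"
  unfolding stop_index_def by (intro Least_le) simp

lemma pred_terminates:
  assumes [measurable]: "\<And>j. j \<ge> 1 \<Longrightarrow> Measurable.pred M (\<lambda>\<omega>. stops \<omega> j)"
  shows "Measurable.pred M (\<lambda>\<omega>. terminates (stops \<omega>))"
proof -
  have [measurable]: "Measurable.pred M (\<lambda>\<omega>. j \<ge> 1 \<and> stops \<omega> j)" for j
    by (cases "j \<ge> 1") auto
  show ?thesis unfolding terminates_def by measurable
qed

text \<open>The random index takes countably many values and is measurable, so the property can be
  checked at each fixed index.\<close>

lemma pred_stop_index: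
  assumes [measurable]: "\<And>j. j \<ge> 1 \<Longrightarrow> Measurable.pred M (\<lambda>\<omega>. stops \<omega> j)"
    and [measurable]: "\<And>j. Measurable.pred M (\<lambda>\<omega>. P \<omega> j)"
  shows "Measurable.pred M (\<lambda>\<omega>. P \<omega> (stop_index (stops \<omega>)))"
proof -
  have [measurable]: "Measurable.pred M (\<lambda>\<omega>. j \<ge> 1 \<and> stops \<omega> j)" for j
    by (cases "j \<ge> 1") auto
  have "(\<lambda>\<omega>. stop_index (stops \<omega>)) \<in> M \<rightarrow>\<^sub>M count_space UNIV"
    unfolding stop_index_def by measurable
  from measurable_compose_countable[OF assms(2) this] show ?thesis .
qed

text \<open>For a run that never stops the set may be infinite, and \<open>card\<close> is then 0.
  This is why the counts are later paired with \<open>terminates\<close>.\<close>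

lemma measurable_card_executed:
  assumes [measurable]: "\<And>j. j \<ge> 1 \<Longrightarrow> Measurable.pred M (\<lambda>\<omega>. stops \<omega> j)"
    and [measurable]: "\<And>j. j \<ge> 1 \<Longrightarrow> Measurable.pred M (\<lambda>\<omega>. P \<omega> j)"
  shows "(\<lambda>\<omega>. real (card {j. executed (stops \<omega>) j \<and> P \<omega> j})) \<in> borel_measurable M"
proof -
  have [measurable]: "Measurable.pred M (\<lambda>\<omega>. 1 \<le> i \<and> i < j \<longrightarrow> \<not> stops \<omega> i)" for i j
    by (cases "1 \<le> i") auto
  have "Measurable.pred M (\<lambda>\<omega>. executed (stops \<omega>) j \<and> P \<omega> j)" for j
    unfolding executed_def by (cases "j \<ge> 1") (auto, measurable)
  then have "(\<lambda>\<omega>. card {j. executed (stops \<omega>) j \<and> P \<omega> j}) \<in> M \<rightarrow>\<^sub>M count_space UNIV"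
    by (intro measurable_card) (simp add: pred_def)
  then show ?thesis by measurable
qed

section \<open>Telescoping and one-step decrease\<close>

lemma sum_decrease_le:
  fixes f :: "'x \<Rightarrow> real"
  assumes "\<And>j. 1 \<le> j \<Longrightarrow> j < m \<Longrightarrow> f (X (Suc j)) \<le> f (X j) - d j" "m \<ge> 1"
  shows "f (X m) + sum d {1..<m} \<le> f (X 1)"
  using assms(2,1)
proof (induction m rule: dec_induct)
  case (step m)
  then have "f (X m) + sum d {1..<m} \<le> f (X 1)" "f (X (Suc m)) \<le> f (X m) - d m" by auto
  moreover have "sum d {1..<Suc m} = sum d {1..<m} + d m" using step.hyps by simp
  ultimately show ?case by linarith
qed simp

lemma transpose_avg:
  assumes "\<And>A. A \<in> set As \<Longrightarrow> transpose A = A"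
  shows "transpose (avg As :: real^'n^'n) = avg As"
proof -
  have "transpose (sum_list As) = sum_list As"
    using assms by (induction As) (auto simp: transpose_def vec_eq_iff)
  then show ?thesis by (simp add: avg_def transpose_scalar)
qed

lemma avg_map_upt: "avg (map h [0..<m]) = (1 / real m) *\<^sub>R (\<Sum>i<m. h i)"
  by (simp add: avg_def sum_list_sum_nth atLeast0LessThan)

text \<open>The gradient error enters through its inner product with \<open>g\<close>, which Young's
  inequality bounds by \<open>e\<^sup>2 + (norm g)\<^sup>2 / 4\<close>. The constant
  \<open>1 / (2 * sqrt 2)\<close> is the one that turns \<open>e\<^sup>2\<close> into
  \<open>\<epsilon>\<^sup>2 / 8\<close>.\<close>

lemma stochastic_gradient_decrease:
  fixes g :: "real^'n"
  assumes upper: "\<And>v. f (x + v) \<le> f x + v \<bullet> \<gamma> + L / 2 * (norm v)\<^sup>2"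
    and L: "L > 0" and g: "norm (g - \<gamma>) \<le> e" and e: "e \<le> 1 / (2 * sqrt 2) * \<epsilon>"
  shows "f (x - (1 / L) *\<^sub>R g) \<le> f x - ((norm g)\<^sup>2 / (4 * L) - \<epsilon>\<^sup>2 / (8 * L))"
proof -
  have e0: "e \<ge> 0" using g norm_ge_zero order_trans by blast
  have "e\<^sup>2 \<le> (1 / (2 * sqrt 2) * \<epsilon>)\<^sup>2" using e e0 by (rule power_mono)
  then have e2: "e\<^sup>2 \<le> \<epsilon>\<^sup>2 / 8" by (simp add: power_mult_distrib power_divide)
  have "(g - \<gamma>) \<bullet> g \<le> e * norm g"
    using norm_cauchy_schwarz[of "g - \<gamma>" g] mult_right_mono[OF g norm_ge_zero[of g]] by linarith
  also have "\<dots> \<le> e\<^sup>2 + (norm g)\<^sup>2 / 4"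
    using zero_le_power2[of "e - norm g / 2"] by (simp add: power2_eq_square algebra_simps)
  finally have dev: "(norm g)\<^sup>2 - g \<bullet> \<gamma> \<le> \<epsilon>\<^sup>2 / 8 + (norm g)\<^sup>2 / 4"
    using e2 by (simp only: inner_diff_left inner_commute[of \<gamma>] power2_norm_eq_inner)
  have "f (x - (1 / L) *\<^sub>R g) \<le> f x - (1 / L) * (g \<bullet> \<gamma>) + L / 2 * ((1 / L) * norm g)\<^sup>2"
    using upper[of "- (1 / L) *\<^sub>R g"] L by simp
  also have "L / 2 * ((1 / L) * norm g)\<^sup>2 = (1 / L) * ((norm g)\<^sup>2 / 2)"
    using L by (simp add: power2_eq_square)
  also have "f x - (1 / L) * (g \<bullet> \<gamma>) + (1 / L) * ((norm g)\<^sup>2 / 2)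
    = f x + (1 / L) * ((norm g)\<^sup>2 - g \<bullet> \<gamma> - (norm g)\<^sup>2 / 2)"
    by (simp add: algebra_simps)
  also have "\<dots> \<le> f x + (1 / L) * (\<epsilon>\<^sup>2 / 8 - (norm g)\<^sup>2 / 4)"
    using dev L by (intro add_left_mono mult_left_mono) auto
  finally show ?thesis by (simp add: algebra_simps)
qed

text \<open>The sign makes the linear term against \<open>g\<close> nonpositive. In units of
  \<open>\<epsilon> ^ 3 / (48 * L\<^sup>2)\<close>, the gradient error costs 2, the Hessian error 1
  and the cubic remainder 8: together the 11 of the test.\<close>

lemma negative_curvature_decrease:
  fixes f :: "real^'n \<Rightarrow> real"
  assumes f: "twice_differentiable f"
    and lip: "\<And>y. spectral_norm (hessian f y - hessian f x) \<le> L * norm (y - x)"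
    and L: "L > 0" and \<epsilon>: "\<epsilon> > 0" and v: "norm v = 1"
    and g: "norm (g - gradient f x) \<le> \<epsilon>\<^sup>2 / (24 * L)"
    and H: "spectral_norm (H - hessian f x) \<le> \<epsilon> / 24"
  shows "f (x - (\<epsilon> / L * sign_pm (v \<bullet> g)) *\<^sub>R v)
    \<le> f x - (- (\<epsilon>\<^sup>2 / (2 * L\<^sup>2)) * (v \<bullet> (H *v v)) - 11 * \<epsilon> ^ 3 / (48 * L\<^sup>2))"
proof -
  define s where "s = - sign_pm (v \<bullet> g)"
  have s: "s * s = 1" "s * (v \<bullet> g) \<le> 0" "\<bar>s\<bar> = 1" by (auto simp: s_def sign_pm_def)
  let ?t = "\<epsilon> / L" and ?\<gamma> = "gradient f x"
  have t: "?t > 0" using \<epsilon> L by simp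
  have "\<bar>v \<bullet> (g - ?\<gamma>)\<bar> \<le> \<epsilon>\<^sup>2 / (24 * L)"
    using Cauchy_Schwarz_ineq2[of v "g - ?\<gamma>"] v g by simp
  then have "\<bar>s * (v \<bullet> (g - ?\<gamma>))\<bar> \<le> \<epsilon>\<^sup>2 / (24 * L)"
    by (simp add: abs_mult s)
  then have lin: "s * (v \<bullet> ?\<gamma>) \<le> \<epsilon>\<^sup>2 / (24 * L)"
    using s(2) by (simp add: inner_diff_right algebra_simps)
  have "\<bar>v \<bullet> ((H - hessian f x) *v v)\<bar> \<le> \<epsilon> / 24"
    using H v by (rule spectral_norm_quadratic_form)
  then have quad: "v \<bullet> (hessian f x *v v) \<le> v \<bullet> (H *v v) + \<epsilon> / 24"
    by (simp only: matrix_vector_mult_diff_rdistrib inner_diff_right abs_le_iff) linarith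
  have "f (x + ?t *\<^sub>R (s *\<^sub>R v)) \<le> f x + ?t * ((s *\<^sub>R v) \<bullet> ?\<gamma>)
      + ?t\<^sup>2 / 2 * ((s *\<^sub>R v) \<bullet> (hessian f x *v (s *\<^sub>R v))) + L * ?t ^ 3 / 6"
    using t v s(3) by (intro cubic_upper_bound f lip) auto
  also have "\<dots> = f x + ?t * (s * (v \<bullet> ?\<gamma>)) + ?t\<^sup>2 / 2 * (v \<bullet> (hessian f x *v v)) + L * ?t ^ 3 / 6"
    using s(1) by (simp add: matrix_vector_mult_scaleR mult.assoc[symmetric])
  also have "\<dots> \<le> f x + ?t * (\<epsilon>\<^sup>2 / (24 * L)) + ?t\<^sup>2 / 2 * (v \<bullet> (H *v v) + \<epsilon> / 24) + L * ?t ^ 3 / 6"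
    using lin quad t by (intro add_mono mult_left_mono order_refl) auto
  also have "\<dots> = f x - (- (\<epsilon>\<^sup>2 / (2 * L\<^sup>2)) * (v \<bullet> (H *v v)) - 11 * \<epsilon> ^ 3 / (48 * L\<^sup>2))"
    using L by (simp add: field_simps power2_eq_square power3_eq_cube)
  finally show ?thesis by (simp add: s_def)
qed

subsection \<open>The stochastic negative curvature algorithms\<close>

text \<open>The setting shared by both algorithms. The batch sizes enter through
  \<open>accurate\<close> and through \<open>b\<^sub>2_pos\<close>, which makes the list passed to
  the PCA routine nonempty.\<close>

locale sncg_problem =
  fixes D :: "'a measure" and R :: "'s measure"
    and F :: "real^'n \<Rightarrow> 'a \<Rightarrow> real" and f :: "real^'n \<Rightarrow> real"
    and x\<^sub>0 x_star :: "real^'n"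
    and L\<^sub>1 L\<^sub>2 \<Delta> \<epsilon>\<^sub>1 \<epsilon>\<^sub>2 \<epsilon>\<^sub>3 \<epsilon>\<^sub>4 \<delta> \<delta>' T\<^sub>g T\<^sub>h C :: real and k :: nat
    and b\<^sub>1 b\<^sub>2 :: "nat \<Rightarrow> nat"
    and pca :: "(real^'n^'n) list \<Rightarrow> real \<Rightarrow> 's \<Rightarrow> real^'n"
    and pca_time :: "(real^'n^'n) list \<Rightarrow> real \<Rightarrow> 's \<Rightarrow> real"
    and A :: "('a, 's, 'n) sncg"
  assumes prob_D: "prob_space D" and prob_R: "prob_space R"
    and f_def: "\<And>x. integrable D (F x)" "\<And>x. f x = (\<integral>\<xi>. F x \<xi> \<partial>D)"
    and pos: "L\<^sub>1 > 0" "L\<^sub>2 > 0" "\<epsilon>\<^sub>1 > 0" "\<epsilon>\<^sub>2 > 0"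
    and cost_pos: "T\<^sub>g > 0" "T\<^sub>h > 0" "C > 0"
    and \<delta>: "0 < \<delta>" "\<delta> < 1"
    and F_smooth: "\<And>\<xi>. \<xi> \<in> space D \<Longrightarrow> twice_differentiable (\<lambda>x. F x \<xi>)"
      "\<And>\<xi> x y. \<xi> \<in> space D \<Longrightarrow>
         norm (gradient (\<lambda>x. F x \<xi>) x - gradient (\<lambda>x. F x \<xi>) y) \<le> L\<^sub>1 * norm (x - y)"
    and f_smooth: "twice_differentiable f"
      "\<And>x y. spectral_norm (hessian f x - hessian f y) \<le> L\<^sub>2 * norm (x - y)"
    and gap: "\<And>x. f x_star \<le> f x" "f x\<^sub>0 - f x_star \<le> \<Delta>"
    and \<epsilon>\<^sub>3_le: "\<epsilon>\<^sub>3 \<le> \<epsilon>\<^sub>2 / 24"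
    and \<epsilon>\<^sub>4_le: "\<epsilon>\<^sub>4 \<le> min (1 / (2 * sqrt 2) * \<epsilon>\<^sub>1) (\<epsilon>\<^sub>2\<^sup>2 / (24 * L\<^sub>2))"
    and \<delta>'_def: "\<delta>' = \<delta> / (1 + max (48 * L\<^sub>2\<^sup>2 / \<epsilon>\<^sub>2 ^ 3) (8 * L\<^sub>1 / \<epsilon>\<^sub>1\<^sup>2) * \<Delta>)"
    and A_def: "A = \<lparr>loss = F, size1 = b\<^sub>1, size2 = b\<^sub>2, routine = pca,
                  Lip1 = L\<^sub>1, Lip2 = L\<^sub>2, eps1 = \<epsilon>\<^sub>1, eps2 = \<epsilon>\<^sub>2, start = x\<^sub>0\<rparr>"
    and b\<^sub>2_pos: "\<And>j. j \<ge> 1 \<Longrightarrow> b\<^sub>2 j > 0"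
    and accurate: "\<And>j x. j \<ge> 1 \<Longrightarrow>
      measure (fresh_space D R) {z \<in> space (fresh_space D R).
        norm (stoch_grad A j x z - gradient f x) \<le> \<epsilon>\<^sub>4 \<and>
        spectral_norm (stoch_hess A j x z - hessian f x) \<le> \<epsilon>\<^sub>3} \<ge> 1 - \<delta>'"
    and approx_pca: "approx_pca R L\<^sub>1 \<delta>' T\<^sub>h C k pca pca_time"
begin

lemma A_simps[simp]:
  "loss A = F" "size1 A = b\<^sub>1" "size2 A = b\<^sub>2" "routine A = pca" "Lip1 A = L\<^sub>1" "Lip2 A = L\<^sub>2"
  "eps1 A = \<epsilon>\<^sub>1" "eps2 A = \<epsilon>\<^sub>2" "start A = x\<^sub>0"
  by (simp_all add: A_def)

abbreviation "seqs \<equiv> \<Pi>\<^sub>M i\<in>(UNIV::nat set). D"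

abbreviation "fresh \<equiv> fresh_space D R"

sublocale D: prob_space D by (rule prob_D)

sublocale R: prob_space R by (rule prob_R)

sublocale seqs: product_prob_space "\<lambda>_. D" "UNIV :: nat set" ..

sublocale seqs_R: pair_prob_space seqs R ..

text \<open>The rewriting states the inherited product-measure facts for
  \<open>fresh_space D R\<close> in folded form; the same is done below for
  \<open>run_space D R\<close>.\<close>

sublocale fresh: pair_prob_space seqs "seqs \<Otimes>\<^sub>M R"
  rewrites "seqs \<Otimes>\<^sub>M (seqs \<Otimes>\<^sub>M R) = fresh"
  by (unfold_locales) (simp add: fresh_space_def)

sublocale run: sequence_space fresh
  rewrites "(\<Pi>\<^sub>M i\<in>UNIV. fresh) = run_space D R"
  by (unfold_locales) (simp add: run_space_def)

lemma space_fresh: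
  "z \<in> space fresh \<Longrightarrow> fst z i \<in> space D \<and> fst (snd z) i \<in> space D \<and> snd (snd z) \<in> space R"
  by (auto simp: fresh_space_def space_pair_measure space_PiM)

lemma space_runD: "\<omega> \<in> space (run_space D R) \<Longrightarrow> \<omega> j \<in> space fresh"
  by (auto simp: run_space_def space_PiM)

lemma measurable_fresh[measurable]:
  "(\<lambda>z. fst z i) \<in> fresh \<rightarrow>\<^sub>M D"
  "(\<lambda>z. fst (snd z) i) \<in> fresh \<rightarrow>\<^sub>M D"
  "(\<lambda>z. snd (snd z)) \<in> fresh \<rightarrow>\<^sub>M R"
  unfolding fresh_space_def by measurable

lemma hessian_sample:
  assumes "\<xi> \<in> space D"
  shows "transpose (hessian (\<lambda>y. F y \<xi>) x) = hessian (\<lambda>y. F y \<xi>) x"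
    and "spectral_norm (hessian (\<lambda>y. F y \<xi>) x) \<le> L\<^sub>1"
  by (rule transpose_hessian[OF F_smooth(1)[OF assms]])
    (rule spectral_norm_hessian_le[OF F_smooth(1)[OF assms] F_smooth(2)[OF assms]])

lemma hess_batch_admissible:
  assumes "j \<ge> 1" "z \<in> space fresh"
  shows "hess_batch A j x z \<noteq> []" "length (hess_batch A j x z) = b\<^sub>2 j"
    "\<forall>H\<in>set (hess_batch A j x z). transpose H = H \<and> spectral_norm H \<le> L\<^sub>1"
  using b\<^sub>2_pos[OF assms(1)] hessian_sample space_fresh[OF assms(2)] by (auto simp: hess_batch_def)

lemma transpose_stoch_hess:
  assumes "j \<ge> 1" "z \<in> space fresh"
  shows "transpose (stoch_hess A j x z) = stoch_hess A j x z"
  unfolding stoch_hess_def using hess_batch_admissible(3)[OF assms] by (intro transpose_avg) blast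

lemma norm_pca:
  assumes "j \<ge> 1" "z \<in> space fresh" "\<epsilon> > 0"
  shows "norm (pca (hess_batch A j x z) \<epsilon> (snd (snd z))) = 1"
  using approx_pca[unfolded approx_pca_def, THEN conjunct2, rule_format,
      of "hess_batch A j x z" \<epsilon>, THEN conjunct1]
    hess_batch_admissible[OF assms(1,2)] assms(3) space_fresh[OF assms(2)] by blast

section \<open>Measurability of the sampled quantities and of one step\<close>

lemma measurable_gradient_f[measurable]: "gradient f \<in> borel_measurable borel"
proof (intro borel_measurable_continuous_onI differentiable_imp_continuous_on)
  show "gradient f differentiable_on UNIV"
    using f_smooth(1) by (simp add: twice_differentiable_def differentiable_on_def)
qed

text \<open>Here \<open>f\<close> is viewed as a family constant in the sample, so that the joint
  statement applies; fixing one sample removes the dummy argument.\<close>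

lemma measurable_hessian_f[measurable]: "hessian f \<in> borel_measurable borel"
proof -
  have "(\<lambda>(x, _). hessian (\<lambda>y. f y) x) \<in> borel_measurable (borel \<Otimes>\<^sub>M D)"
    using borel_measurable_hessian[of "\<lambda>x _. f x" D] f_smooth(1) by simp
  moreover obtain \<xi> where "\<xi> \<in> space D" using D.not_empty by blast
  ultimately show ?thesis
    using measurable_compose[of "\<lambda>x. (x, \<xi>)" borel "borel \<Otimes>\<^sub>M D" "\<lambda>(x, _). hessian (\<lambda>y. f y) x" borel] by simp
qed

lemma measurable_sample_gradient[measurable]:
  "(\<lambda>p. gradient (\<lambda>y. F y (fst (snd p) i)) (fst p)) \<in> borel_measurable (borel \<Otimes>\<^sub>M fresh)"
proof -
  have "(\<lambda>(x, \<xi>). gradient (\<lambda>y. F y \<xi>) x) \<in> borel_measurable (borel \<Otimes>\<^sub>M D)"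
    using F_smooth(1) f_def(1) by (intro borel_measurable_gradient) (auto simp: twice_differentiable_def)
  from measurable_compose[OF _ this, of "\<lambda>p. (fst p, fst (snd p) i)" "borel \<Otimes>\<^sub>M fresh"]
  show ?thesis by simp
qed

lemma measurable_sample_hessian[measurable]:
  "(\<lambda>p. hessian (\<lambda>y. F y (fst (snd (snd p)) i)) (fst p)) \<in> borel_measurable (borel \<Otimes>\<^sub>M fresh)"
proof -
  have "(\<lambda>(x, \<xi>). hessian (\<lambda>y. F y \<xi>) x) \<in> borel_measurable (borel \<Otimes>\<^sub>M D)"
    using F_smooth(1) f_def(1) by (intro borel_measurable_hessian) auto
  from measurable_compose[OF _ this, of "\<lambda>p. (fst p, fst (snd (snd p)) i)" "borel \<Otimes>\<^sub>M fresh"]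
  show ?thesis by simp
qed

lemma measurable_stoch_grad[measurable]:
  "(\<lambda>p. stoch_grad A j (fst p) (snd p)) \<in> borel_measurable (borel \<Otimes>\<^sub>M fresh)"
  unfolding stoch_grad_def avg_map_upt A_simps by measurable

lemma measurable_stoch_hess[measurable]:
  "(\<lambda>p. stoch_hess A j (fst p) (snd p)) \<in> borel_measurable (borel \<Otimes>\<^sub>M fresh)"
  unfolding stoch_hess_def hess_batch_def avg_map_upt A_simps by measurable

text \<open>The measurability clause of \<open>approx_pca\<close> takes the matrices as a function
  on \<open>{..<m}\<close>, which avoids a sigma-algebra on lists; the batch is the
  \<open>map\<close> of such a function.\<close>

lemma measurable_pca:
  assumes j: "j \<ge> 1" and [measurable]: "e \<in> borel_measurable (borel \<Otimes>\<^sub>M fresh)"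
  shows "(\<lambda>p. pca (hess_batch A j (fst p) (snd p)) (e p) (snd (snd (snd p))))
    \<in> borel_measurable (borel \<Otimes>\<^sub>M fresh)"
proof -
  let ?h = "\<lambda>p. \<lambda>i\<in>{..<b\<^sub>2 j}. hessian (\<lambda>y. F y (fst (snd (snd p)) i)) (fst p)"
  have "(\<lambda>(Hs, \<epsilon>, u). pca (map Hs [0..<b\<^sub>2 j]) \<epsilon> u)
        \<in> borel_measurable ((\<Pi>\<^sub>M i\<in>{..<b\<^sub>2 j}. borel) \<Otimes>\<^sub>M (borel \<Otimes>\<^sub>M R))"
    using approx_pca b\<^sub>2_pos[OF j] unfolding approx_pca_def by blast
  from measurable_compose[OF _ this, of "\<lambda>p. (?h p, e p, snd (snd (snd p)))" "borel \<Otimes>\<^sub>M fresh"]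
  have "(\<lambda>p. pca (map (?h p) [0..<b\<^sub>2 j]) (e p) (snd (snd (snd p)))) \<in> borel_measurable (borel \<Otimes>\<^sub>M fresh)"
    by simp
  moreover have "map (?h p) [0..<b\<^sub>2 j] = hess_batch A j (fst p) (snd p)" for p
    by (simp add: hess_batch_def)
  ultimately show ?thesis by simp
qed

lemma measurable_ncg_s:
  assumes j: "j \<ge> 1" and e: "e \<in> borel_measurable (borel \<Otimes>\<^sub>M fresh)"
  shows "(\<lambda>p. fst (ncg_s A j (fst p) (e p) (snd p))) \<in> borel_measurable (borel \<Otimes>\<^sub>M fresh)"
    and "(\<lambda>p. snd (ncg_s A j (fst p) (e p) (snd p))) \<in> borel_measurable (borel \<Otimes>\<^sub>M fresh)"
proof -
  note [measurable] = measurable_pca[OF j e]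
  show "(\<lambda>p. fst (ncg_s A j (fst p) (e p) (snd p))) \<in> borel_measurable (borel \<Otimes>\<^sub>M fresh)"
    unfolding ncg_s_def Let_def fst_conv A_simps sign_pm_def by measurable
  show "(\<lambda>p. snd (ncg_s A j (fst p) (e p) (snd p))) \<in> borel_measurable (borel \<Otimes>\<^sub>M fresh)"
    unfolding ncg_s_def Let_def snd_conv A_simps by measurable
qed

section \<open>Success of the sampling and of the PCA routine in one iteration\<close>

text \<open>A set of pairs of iterate and fresh triple, not of runs: the form in which a bound at
  fixed points transfers to trajectories.\<close>

definition accurate_set :: "nat \<Rightarrow> ((real^'n) \<times> ('a, 's) fresh) set" where
  "accurate_set j = {p \<in> space (borel \<Otimes>\<^sub>M fresh).
     norm (stoch_grad A j (fst p) (snd p) - gradient f (fst p)) \<le> \<epsilon>\<^sub>4 \<and>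
     spectral_norm (stoch_hess A j (fst p) (snd p) - hessian f (fst p)) \<le> \<epsilon>\<^sub>3}"

lemma accurate_set:
  assumes "j \<ge> 1"
  shows "accurate_set j \<in> sets (borel \<Otimes>\<^sub>M fresh)"
    and "measure fresh {z \<in> space fresh. (x, z) \<in> accurate_set j} \<ge> 1 - \<delta>'"
proof -
  show "accurate_set j \<in> sets (borel \<Otimes>\<^sub>M fresh)"
    unfolding accurate_set_def by measurable
  have "{z \<in> space fresh. (x, z) \<in> accurate_set j} = {z \<in> space fresh.
        norm (stoch_grad A j x z - gradient f x) \<le> \<epsilon>\<^sub>4 \<and>
        spectral_norm (stoch_hess A j x z - hessian f x) \<le> \<epsilon>\<^sub>3}"
    by (auto simp: accurate_set_def space_pair_measure)
  then show "measure fresh {z \<in> space fresh. (x, z) \<in> accurate_set j} \<ge> 1 - \<delta>'"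
    using accurate[OF assms] by simp
qed

text \<open>The accuracy \<open>e\<close> is a parameter because SNCG-1 adapts it to the sampled
  gradient while SNCG-2 keeps it constant.\<close>

definition pca_set :: "(nat \<Rightarrow> real^'n \<Rightarrow> ('a, 's) fresh \<Rightarrow> real) \<Rightarrow> nat \<Rightarrow> ((real^'n) \<times> ('a, 's) fresh) set" where
  "pca_set e j = {p \<in> space (borel \<Otimes>\<^sub>M fresh).
     lambda_min (stoch_hess A j (fst p) (snd p))
       \<ge> snd (ncg_s A j (fst p) (e j (fst p) (snd p)) (snd p)) - e j (fst p) (snd p)}"

text \<open>The accuracy may depend on the gradient samples, but not on what is drawn after them.\<close>

lemma pca_set:
  assumes j: "j \<ge> 1"
    and e[measurable]: "(\<lambda>p. e j (fst p) (snd p)) \<in> borel_measurable (borel \<Otimes>\<^sub>M fresh)"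
    and e_pos: "\<And>x z. e j x z > 0"
    and e_dep: "\<And>x s q q'. e j x (s, q) = e j x (s, q')"
  shows "pca_set e j \<in> sets (borel \<Otimes>\<^sub>M fresh)"
    and "measure fresh {z \<in> space fresh. (x, z) \<in> pca_set e j} \<ge> 1 - \<delta>'"
proof -
  note [measurable] = measurable_ncg_s[OF j e]
  have [measurable]: "(\<lambda>p. lambda_min (stoch_hess A j (fst p) (snd p))) \<in> borel_measurable (borel \<Otimes>\<^sub>M fresh)"
    using transpose_stoch_hess[OF j] by (intro borel_measurable_lambda_min) (auto simp: space_pair_measure)
  show P[measurable]: "pca_set e j \<in> sets (borel \<Otimes>\<^sub>M fresh)"
    unfolding pca_set_def by measurable
  let ?B = "{z \<in> space fresh. (x, z) \<notin> pca_set e j}"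
  have B[measurable]: "?B \<in> sets fresh" by measurable
  then have B': "?B \<in> sets (seqs \<Otimes>\<^sub>M (seqs \<Otimes>\<^sub>M R))" by (simp add: fresh_space_def)
  \<comment> \<open>Fixing both sample sequences freezes the Hessian batch and, by
    \<open>e_dep\<close>, the accuracy. Only the seed is still random, so the guarantee for a fixed
    input applies; two applications of Fubini then integrate over the sequences.\<close>
  have inner: "emeasure R (Pair s\<^sub>2 -` Pair s\<^sub>1 -` ?B) \<le> ennreal \<delta>'"
    if s: "s\<^sub>1 \<in> space seqs" "s\<^sub>2 \<in> space seqs" for s\<^sub>1 s\<^sub>2
  proof -
    obtain u\<^sub>0 where u\<^sub>0: "u\<^sub>0 \<in> space R" using R.not_empty by blast
    have z: "(s\<^sub>1, s\<^sub>2, u) \<in> space fresh \<longleftrightarrow> u \<in> space R" for u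
      using s by (simp add: fresh_space_def space_pair_measure)
    define Hs where "Hs = hess_batch A j x (s\<^sub>1, s\<^sub>2, u\<^sub>0)"
    define \<epsilon> where "\<epsilon> = e j x (s\<^sub>1, s\<^sub>2, u\<^sub>0)"
    have Hs: "hess_batch A j x (s\<^sub>1, s\<^sub>2, u) = Hs" and \<epsilon>: "e j x (s\<^sub>1, s\<^sub>2, u) = \<epsilon>" for u
      unfolding Hs_def \<epsilon>_def by (simp add: hess_batch_def, rule e_dep)
    have adm: "Hs \<noteq> []" "\<forall>H\<in>set Hs. transpose H = H \<and> spectral_norm H \<le> L\<^sub>1" "\<epsilon> > 0"
      using hess_batch_admissible[OF j, of "(s\<^sub>1, s\<^sub>2, u\<^sub>0)" x] u\<^sub>0 z e_pos unfolding Hs_def \<epsilon>_def by auto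
    let ?G = "{u \<in> space R. lambda_min (avg Hs) \<ge> pca Hs \<epsilon> u \<bullet> (avg Hs *v pca Hs \<epsilon> u) - \<epsilon>}"
    have "measure R ?G \<ge> 1 - \<delta>'"
      using approx_pca adm unfolding approx_pca_def by blast
    moreover have eq: "Pair s\<^sub>2 -` Pair s\<^sub>1 -` ?B = space R - ?G"
      using s z by (auto simp: pca_set_def ncg_s_def Let_def stoch_hess_def Hs \<epsilon> space_pair_measure)
    \<comment> \<open>The guarantee bounds \<open>measure R ?G\<close> without asserting that
      \<open>?G\<close> is measurable; this is recovered from the section of \<open>?B\<close>, its
      complement.\<close>
    moreover have "?G \<in> sets R"
    proof -
      have "Pair s\<^sub>2 -` Pair s\<^sub>1 -` ?B \<in> sets R" by (rule sets_Pair1[OF sets_Pair1[OF B']])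
      then have "space R - (space R - ?G) \<in> sets R" unfolding eq by (rule sets.compl_sets)
      moreover have "space R - (space R - ?G) = ?G" by blast
      ultimately show ?thesis by simp
    qed
    ultimately have "measure R (Pair s\<^sub>2 -` Pair s\<^sub>1 -` ?B) \<le> \<delta>'"
      using R.prob_compl[of ?G] by simp
    then show ?thesis by (simp add: R.emeasure_eq_measure ennreal_leI)
  qed
  have "emeasure (seqs \<Otimes>\<^sub>M R) (Pair s\<^sub>1 -` ?B) \<le> ennreal \<delta>'" if "s\<^sub>1 \<in> space seqs" for s\<^sub>1
  proof -
    have "emeasure (seqs \<Otimes>\<^sub>M R) (Pair s\<^sub>1 -` ?B) = (\<integral>\<^sup>+s\<^sub>2. emeasure R (Pair s\<^sub>2 -` Pair s\<^sub>1 -` ?B) \<partial>seqs)"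
      by (rule R.emeasure_pair_measure_alt[OF sets_Pair1[OF B']])
    also have "\<dots> \<le> (\<integral>\<^sup>+s\<^sub>2. ennreal \<delta>' \<partial>seqs)"
      using inner that by (intro nn_integral_mono) blast
    finally show ?thesis by (simp add: seqs.P.emeasure_space_1)
  qed
  then have "(\<integral>\<^sup>+s\<^sub>1. emeasure (seqs \<Otimes>\<^sub>M R) (Pair s\<^sub>1 -` ?B) \<partial>seqs) \<le> (\<integral>\<^sup>+s\<^sub>1. ennreal \<delta>' \<partial>seqs)"
    by (intro nn_integral_mono) blast
  moreover have "emeasure fresh ?B = (\<integral>\<^sup>+s\<^sub>1. emeasure (seqs \<Otimes>\<^sub>M R) (Pair s\<^sub>1 -` ?B) \<partial>seqs)"
    unfolding fresh_space_def
    by (rule seqs_R.P.emeasure_pair_measure_alt[OF B', unfolded fresh_space_def])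
  ultimately have "emeasure fresh ?B \<le> ennreal \<delta>'"
    by (simp add: seqs.P.emeasure_space_1)
  moreover have "\<delta>' \<ge> 0"
    using accurate_set(2)[OF j, of x] fresh.P.prob_le_1[of "{z \<in> space fresh. (x, z) \<in> accurate_set j}"]
    by linarith
  ultimately have "measure fresh ?B \<le> \<delta>'"
    by (simp add: fresh.P.emeasure_eq_measure)
  moreover have "?B = space fresh - {z \<in> space fresh. (x, z) \<in> pca_set e j}" by blast
  moreover have "{z \<in> space fresh. (x, z) \<in> pca_set e j} \<in> sets fresh" by measurable
  ultimately show "measure fresh {z \<in> space fresh. (x, z) \<in> pca_set e j} \<ge> 1 - \<delta>'"
    using fresh.P.prob_compl[of "{z \<in> space fresh. (x, z) \<in> pca_set e j}"] by simp
qed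

section \<open>Iteration horizon and failure budget\<close>

definition "K = max (48 * L\<^sub>2\<^sup>2 / \<epsilon>\<^sub>2 ^ 3) (8 * L\<^sub>1 / \<epsilon>\<^sub>1\<^sup>2)"

definition "N = nat \<lfloor>1 + K * \<Delta>\<rfloor>"

lemma \<Delta>_nonneg: "\<Delta> \<ge> 0"
  using gap(1)[of x\<^sub>0] gap(2) by linarith

lemma K_pos: "K > 0"
  using pos by (simp add: K_def max_def)

lemma inverse_K_le: "1 / K \<le> \<epsilon>\<^sub>2 ^ 3 / (48 * L\<^sub>2\<^sup>2)" "1 / K \<le> \<epsilon>\<^sub>1\<^sup>2 / (8 * L\<^sub>1)"
proof -
  have "inverse K \<le> inverse (48 * L\<^sub>2\<^sup>2 / \<epsilon>\<^sub>2 ^ 3)" "inverse K \<le> inverse (8 * L\<^sub>1 / \<epsilon>\<^sub>1\<^sup>2)"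
    using pos by (intro le_imp_inverse_le; simp add: K_def)+
  then show "1 / K \<le> \<epsilon>\<^sub>2 ^ 3 / (48 * L\<^sub>2\<^sup>2)" "1 / K \<le> \<epsilon>\<^sub>1\<^sup>2 / (8 * L\<^sub>1)"
    by (simp_all add: inverse_eq_divide)
qed

text \<open>The strict lower bound makes \<open>N\<close> decreases of \<open>1 / K\<close> exceed
  \<open>\<Delta>\<close>; the upper bound is the claimed number of steps and also the denominator
  of \<open>\<delta>'\<close>, so that \<open>N\<close> failures of probability
  \<open>\<delta>'\<close> cost at most \<open>\<delta>\<close>.\<close>

lemma N_bounds: "real N \<le> 1 + K * \<Delta>" "real N > K * \<Delta>"
proof -
  have "K * \<Delta> \<ge> 0" using K_pos \<Delta>_nonneg by simp
  then show "real N \<le> 1 + K * \<Delta>" "real N > K * \<Delta>"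
    unfolding N_def by linarith+
qed

lemma \<delta>'_bounds: "\<delta>' > 0" "\<delta>' < 1" "real N * \<delta>' \<le> \<delta>"
proof -
  have K: "1 + K * \<Delta> \<ge> 1" using K_pos \<Delta>_nonneg by simp
  have \<delta>': "\<delta>' = \<delta> / (1 + K * \<Delta>)" by (simp add: \<delta>'_def K_def)
  show "\<delta>' > 0" using \<delta> K by (simp add: \<delta>')
  show "\<delta>' < 1" using \<delta> K by (simp add: \<delta>')
  have "real N * \<delta>' \<le> (1 + K * \<Delta>) * \<delta>'"
    using N_bounds(1) \<open>\<delta>' > 0\<close> by (intro mult_right_mono) auto
  then show "real N * \<delta>' \<le> \<delta>" using K by (simp add: \<delta>')
qed

section \<open>Guarantees at an accurate iterate\<close>

lemma accurate_setD:
  assumes "(x, z) \<in> accurate_set j"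
  shows "z \<in> space fresh" "norm (stoch_grad A j x z - gradient f x) \<le> \<epsilon>\<^sub>4"
    "spectral_norm (stoch_hess A j x z - hessian f x) \<le> \<epsilon>\<^sub>3"
  using assms by (auto simp: accurate_set_def space_pair_measure)

lemma sg_decrease:
  assumes "(x, z) \<in> accurate_set j"
  shows "f (x - (1 / L\<^sub>1) *\<^sub>R stoch_grad A j x z)
    \<le> f x - ((norm (stoch_grad A j x z))\<^sup>2 / (4 * L\<^sub>1) - \<epsilon>\<^sub>1\<^sup>2 / (8 * L\<^sub>1))"
proof (rule stochastic_gradient_decrease)
  \<comment> \<open>The Lipschitz gradient is assumed of the samples; the quadratic bound for
    \<open>f\<close> comes by way of the expectation.\<close>
  show "f (x + v) \<le> f x + v \<bullet> gradient f x + L\<^sub>1 / 2 * (norm v)\<^sup>2" for v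
    using F_smooth f_smooth(1) unfolding twice_differentiable_def
    by (intro expectation_quadratic_upper_bound[OF prob_D f_def]) blast+
qed (use accurate_setD[OF assms] pos \<epsilon>\<^sub>4_le in auto)

lemma ncg_decrease:
  assumes j: "j \<ge> 1" and acc: "(x, z) \<in> accurate_set j" and "\<epsilon> > 0"
  defines "p \<equiv> ncg_s A j x \<epsilon> z"
  shows "f (fst p) \<le> f x - max (- (\<epsilon>\<^sub>2\<^sup>2 / (2 * L\<^sub>2\<^sup>2)) * snd p - 11 * \<epsilon>\<^sub>2 ^ 3 / (48 * L\<^sub>2\<^sup>2))
    ((norm (stoch_grad A j x z))\<^sup>2 / (4 * L\<^sub>1) - \<epsilon>\<^sub>1\<^sup>2 / (8 * L\<^sub>1))"
proof -
  note z = accurate_setD[OF acc]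
  let ?v = "pca (hess_batch A j x z) \<epsilon> (snd (snd z))" and ?g = "stoch_grad A j x z"
  have "f (x - (\<epsilon>\<^sub>2 / L\<^sub>2 * sign_pm (?v \<bullet> ?g)) *\<^sub>R ?v)
    \<le> f x - (- (\<epsilon>\<^sub>2\<^sup>2 / (2 * L\<^sub>2\<^sup>2)) * (?v \<bullet> (stoch_hess A j x z *v ?v)) - 11 * \<epsilon>\<^sub>2 ^ 3 / (48 * L\<^sub>2\<^sup>2))"
    using z \<epsilon>\<^sub>4_le \<epsilon>\<^sub>3_le
    by (intro negative_curvature_decrease f_smooth pos norm_pca j \<open>\<epsilon> > 0\<close>) auto
  then show ?thesis
    using sg_decrease[OF acc] unfolding p_def ncg_s_def Let_def A_simps by auto
qed

text \<open>In units of \<open>\<epsilon>\<^sub>2 ^ 3 / (48 * L\<^sub>2\<^sup>2)\<close>, curvature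
  at most \<open>- \<epsilon>\<^sub>2 / 2\<close> gains 12 and the errors take 11.\<close>

lemma ncg_decrease_curvature:
  assumes "j \<ge> 1" "(x, z) \<in> accurate_set j" "\<epsilon> > 0" and c: "snd (ncg_s A j x \<epsilon> z) \<le> - \<epsilon>\<^sub>2 / 2"
  shows "f (fst (ncg_s A j x \<epsilon> z)) \<le> f x - \<epsilon>\<^sub>2 ^ 3 / (48 * L\<^sub>2\<^sup>2)"
proof -
  have "\<epsilon>\<^sub>2\<^sup>2 / (2 * L\<^sub>2\<^sup>2) * (\<epsilon>\<^sub>2 / 2) \<le> \<epsilon>\<^sub>2\<^sup>2 / (2 * L\<^sub>2\<^sup>2) * - snd (ncg_s A j x \<epsilon> z)"
    using c by (intro mult_left_mono) auto
  moreover have "\<epsilon>\<^sub>2\<^sup>2 / (2 * L\<^sub>2\<^sup>2) * (\<epsilon>\<^sub>2 / 2) = 12 * (\<epsilon>\<^sub>2 ^ 3 / (48 * L\<^sub>2\<^sup>2))"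
    by (simp add: power2_eq_square power3_eq_cube)
  moreover have "f (fst (ncg_s A j x \<epsilon> z))
    \<le> f x - (- (\<epsilon>\<^sub>2\<^sup>2 / (2 * L\<^sub>2\<^sup>2)) * snd (ncg_s A j x \<epsilon> z) - 11 * (\<epsilon>\<^sub>2 ^ 3 / (48 * L\<^sub>2\<^sup>2)))"
    using ncg_decrease[OF assms(1-3)] by simp
  ultimately show ?thesis by linarith
qed

lemma large_gradient_decrease:
  "norm g \<ge> \<epsilon>\<^sub>1 \<Longrightarrow> \<epsilon>\<^sub>1\<^sup>2 / (8 * L\<^sub>1) \<le> (norm g)\<^sup>2 / (4 * L\<^sub>1) - \<epsilon>\<^sub>1\<^sup>2 / (8 * L\<^sub>1)"
  using pos divide_right_mono[of "\<epsilon>\<^sub>1\<^sup>2" "(norm g)\<^sup>2" "4 * L\<^sub>1"] by (simp add: power_mono)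

text \<open>Otherwise \<open>N\<close> decreases of \<open>1 / K\<close> would take \<open>f\<close>
  from \<open>x\<^sub>0\<close> below its minimum. Accuracy beyond iteration \<open>N\<close> is
  never called on, as \<open>dec\<close> reflects.\<close>

lemma terminates_within_N:
  assumes "X 1 = x\<^sub>0"
    and dec: "\<And>j. 1 \<le> j \<Longrightarrow> j \<le> N \<Longrightarrow> \<not> stops j \<Longrightarrow> f (X (Suc j)) \<le> f (X j) - 1 / K"
  shows "terminates stops" "stop_index stops \<le> N"
proof -
  have "\<exists>j. 1 \<le> j \<and> j \<le> N \<and> stops j"
  proof (rule ccontr)
    assume "\<nexists>j. 1 \<le> j \<and> j \<le> N \<and> stops j"
    then have "f (X (Suc N)) + (\<Sum>j\<in>{1..<Suc N}. 1 / K) \<le> f (X 1)"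
      using dec by (intro sum_decrease_le) auto
    then have "real N / K \<le> \<Delta>"
      using gap(1)[of "X (Suc N)"] gap(2) assms(1) by simp
    then show False using N_bounds(2) K_pos by (simp add: divide_simps mult.commute)
  qed
  then obtain j where j: "1 \<le> j" "j \<le> N" "stops j" by blast
  then show "terminates stops" by (auto simp: terminates_def)
  show "stop_index stops \<le> N" using stop_index_le[of j stops] j by simp
qed

lemma norm_gradient_le:
  assumes "(x, z) \<in> accurate_set j" "norm (stoch_grad A j x z) \<le> \<epsilon>\<^sub>1"
  shows "norm (gradient f x) \<le> 2 * \<epsilon>\<^sub>1"
proof -
  have "1 / (2 * sqrt 2) * \<epsilon>\<^sub>1 \<le> 1 * \<epsilon>\<^sub>1"
  proof (rule mult_right_mono)
    have "1 \<le> sqrt 2" by simp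
    then have "1 \<le> 2 * sqrt 2" by linarith
    then show "1 / (2 * sqrt 2) \<le> 1" by (simp add: divide_simps)
  qed (use pos in simp)
  then have "\<epsilon>\<^sub>4 \<le> \<epsilon>\<^sub>1" using \<epsilon>\<^sub>4_le by simp
  then show ?thesis
    using accurate_setD(2)[OF assms(1)] assms(2)
      norm_triangle_ineq3[of "stoch_grad A j x z" "gradient f x"] by linarith
qed

text \<open>The stopping test and the PCA accuracy each cost \<open>\<epsilon>\<^sub>2 / 2\<close>.
  The sampling error costs at most another \<open>\<epsilon>\<^sub>2 / 24\<close> and passes from
  one matrix to the other through the Rayleigh quotient.\<close>

lemma lambda_min_hessian_ge:
  assumes j: "j \<ge> 1" and acc: "(x, z) \<in> accurate_set j" and pca: "(x, z) \<in> pca_set e j"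
    and e: "e j x z \<le> \<epsilon>\<^sub>2 / 2" and c: "snd (ncg_s A j x (e j x z) z) > - \<epsilon>\<^sub>2 / 2"
  shows "lambda_min (hessian f x) \<ge> - 2 * \<epsilon>\<^sub>2"
proof -
  let ?H = "stoch_hess A j x z"
  have H: "lambda_min ?H \<ge> - \<epsilon>\<^sub>2"
    using pca e c by (auto simp: pca_set_def)
  have "- 2 * \<epsilon>\<^sub>2 \<le> w \<bullet> (hessian f x *v w)" if w: "norm w = 1" for w
  proof -
    have "\<bar>w \<bullet> ((?H - hessian f x) *v w)\<bar> \<le> \<epsilon>\<^sub>3"
      using accurate_setD(3)[OF acc] w by (rule spectral_norm_quadratic_form)
    then have "w \<bullet> (?H *v w) - w \<bullet> (hessian f x *v w) \<le> \<epsilon>\<^sub>3"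
      unfolding matrix_vector_mult_diff_rdistrib inner_diff_right by linarith
    moreover have "- \<epsilon>\<^sub>2 \<le> w \<bullet> (?H *v w)"
      using H w le_lambda_min_iff[OF transpose_stoch_hess[OF j accurate_setD(1)[OF acc]]] by blast
    ultimately show ?thesis using \<epsilon>\<^sub>3_le pos by linarith
  qed
  then show ?thesis
    by (simp add: le_lambda_min_iff[OF transpose_hessian[OF f_smooth(1)]])
qed

section \<open>Running time of one step\<close>

text \<open>The rate is written with \<open>2 * \<epsilon>\<close> because both algorithms pass half
  of the quantity in the claimed bound to the routine. Bounding the maximum by a sum and absorbing
  \<open>sqrt 2\<close> gives \<open>2 * C\<close>; gradient sampling and the curvature evaluation
  account for the 1.\<close>

lemma soft_O_bound_ncg_s_time:
  assumes j: "j \<ge> 1" and z: "z \<in> space fresh" and \<epsilon>: "\<epsilon> > 0"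
  shows "soft_O_bound (2 * C + 1) k CARD('n) \<delta>' \<epsilon>
    (ncg_s_time T\<^sub>g T\<^sub>h pca_time A j x \<epsilon> z)
    (T\<^sub>h * real (b\<^sub>2 j) + T\<^sub>h * real (b\<^sub>2 j) powr (3/4) * (sqrt L\<^sub>1 / (2 * \<epsilon>) powr (1/2)) + real (b\<^sub>1 j) * T\<^sub>g)"
proof -
  let ?Hs = "hess_batch A j x z" and ?m = "real (b\<^sub>2 j)"
  let ?a = "T\<^sub>h * ?m" and ?b = "T\<^sub>h * ?m powr (3/4) * (sqrt L\<^sub>1 / (2 * \<epsilon>) powr (1/2))"
    and ?c = "real (b\<^sub>1 j) * T\<^sub>g" and ?\<Lambda> = "log_factor CARD('n) \<delta>' \<epsilon> ^ k"
  \<comment> \<open>This lets the costs without a logarithm be absorbed into the soft-O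
    factor.\<close>
  have log: "log_factor CARD('n) \<delta>' \<epsilon> \<ge> 1"
    using \<delta>'_bounds \<epsilon> by (auto simp: log_factor_def Suc_le_eq intro!: add_nonneg_nonneg ln_ge_zero)
  then have \<Lambda>: "?\<Lambda> \<ge> 1" by (rule one_le_power)
  have nonneg: "?a \<ge> 0" "?b \<ge> 0" "?c \<ge> 0"
    using cost_pos pos by simp_all
  have "soft_O_bound C k CARD('n) \<delta>' \<epsilon> (pca_time ?Hs \<epsilon> (snd (snd z)))
    (T\<^sub>h * max (real (length ?Hs)) (real (length ?Hs) powr (3/4) * sqrt (L\<^sub>1 / \<epsilon>)))"
    using approx_pca[unfolded approx_pca_def, THEN conjunct2, rule_format, of ?Hs \<epsilon>,
        THEN conjunct2, THEN conjunct2]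
      hess_batch_admissible[OF j z] \<epsilon> space_fresh[OF z] by blast
  then have "pca_time ?Hs \<epsilon> (snd (snd z)) \<le> C * ?\<Lambda> * (T\<^sub>h * max ?m (?m powr (3/4) * sqrt (L\<^sub>1 / \<epsilon>)))"
    using hess_batch_admissible(2)[OF j z, of x] by (simp add: soft_O_bound_def)
  also have "\<dots> \<le> C * ?\<Lambda> * (2 * (?a + ?b))"
  proof (rule mult_left_mono)
    have "sqrt (L\<^sub>1 / \<epsilon>) = sqrt 2 * (sqrt L\<^sub>1 / sqrt (2 * \<epsilon>))"
      using \<epsilon> by (simp add: real_sqrt_divide real_sqrt_mult)
    also have "\<dots> \<le> 2 * (sqrt L\<^sub>1 / sqrt (2 * \<epsilon>))"
      using \<epsilon> pos by (intro mult_right_mono) (auto intro: real_le_lsqrt)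
    finally have "sqrt (L\<^sub>1 / \<epsilon>) \<le> 2 * (sqrt L\<^sub>1 / (2 * \<epsilon>) powr (1/2))"
      using \<epsilon> by (simp add: powr_half_sqrt)
    then have "T\<^sub>h * (?m powr (3/4) * sqrt (L\<^sub>1 / \<epsilon>)) \<le> T\<^sub>h * (?m powr (3/4) * (2 * (sqrt L\<^sub>1 / (2 * \<epsilon>) powr (1/2))))"
      using cost_pos by (intro mult_left_mono) auto
    then have "T\<^sub>h * (?m powr (3/4) * sqrt (L\<^sub>1 / \<epsilon>)) \<le> 2 * ?b"
      by (simp add: mult_ac)
    then show "T\<^sub>h * max ?m (?m powr (3/4) * sqrt (L\<^sub>1 / \<epsilon>)) \<le> 2 * (?a + ?b)"
      using nonneg by (auto simp: max_def)
    show "0 \<le> C * ?\<Lambda>" using cost_pos \<Lambda> by simp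
  qed
  also have "\<dots> \<le> C * ?\<Lambda> * (2 * (?a + ?b + ?c))"
    using nonneg cost_pos \<Lambda> by (intro mult_left_mono) auto
  finally have "ncg_s_time T\<^sub>g T\<^sub>h pca_time A j x \<epsilon> z \<le> C * ?\<Lambda> * (2 * (?a + ?b + ?c)) + 1 * (?a + ?b + ?c)"
    using nonneg by (simp add: ncg_s_time_def mult.commute)
  also have "\<dots> \<le> C * ?\<Lambda> * (2 * (?a + ?b + ?c)) + ?\<Lambda> * (?a + ?b + ?c)"
    using nonneg \<Lambda> by (intro add_left_mono mult_right_mono) auto
  also have "\<dots> = (2 * C + 1) * ?\<Lambda> * (?a + ?b + ?c)"
    by (simp only: distrib_right mult_1_left mult.assoc mult.commute[of C 2] mult.left_commute[of _ 2])
  finally show ?thesis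
    by (simp only: soft_O_bound_def)
qed

section \<open>Probability of success along a trajectory\<close>

lemma measurable_trajectory_pair:
  assumes "\<And>j. j \<ge> 1 \<Longrightarrow> (\<lambda>p. step j (fst p) (snd p)) \<in> borel_measurable (borel \<Otimes>\<^sub>M fresh)"
  shows "(\<lambda>\<omega>. (trajectory x\<^sub>0 step \<omega> j, \<omega> j)) \<in> run_space D R \<rightarrow>\<^sub>M borel \<Otimes>\<^sub>M fresh"
proof -
  have "(\<lambda>\<omega>. trajectory x\<^sub>0 step \<omega> j) \<in> borel_measurable (run_space D R)"
    unfolding run_space_def using assms by (intro measurable_trajectory) (simp_all add: case_prod_beta)
  moreover have "(\<lambda>\<omega>. \<omega> j) \<in> run_space D R \<rightarrow>\<^sub>M fresh"
    unfolding run_space_def by simp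
  ultimately show ?thesis by (rule measurable_Pair)
qed

lemma prob_trajectory_accurate:
  assumes "\<And>j. j \<ge> 1 \<Longrightarrow> (\<lambda>p. step j (fst p) (snd p)) \<in> borel_measurable (borel \<Otimes>\<^sub>M fresh)"
  shows "measure (run_space D R) {\<omega> \<in> space (run_space D R).
    \<forall>j\<in>{1..N}. (trajectory x\<^sub>0 step \<omega> j, \<omega> j) \<in> accurate_set j} \<ge> 1 - \<delta>"
proof -
  have "measure (run_space D R) {\<omega> \<in> space (run_space D R).
    \<forall>j\<in>{1..N}. (trajectory x\<^sub>0 step \<omega> j, \<omega> j) \<in> accurate_set j} \<ge> 1 - real N * \<delta>'"
    using assms accurate_set by (intro run.prob_trajectory_ge[where N = borel]) (auto simp: case_prod_beta)
  then show ?thesis using \<delta>'_bounds(3) by linarith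
qed

text \<open>Each iteration fails with probability at most \<open>2 * \<delta>'\<close>, by inclusion
  and exclusion, so the first \<open>N\<close> fail with at most \<open>2 * \<delta>\<close>, within
  the stated \<open>3 * \<delta>\<close>.\<close>

lemma prob_trajectory_accurate_pca:
  assumes "\<And>j. j \<ge> 1 \<Longrightarrow> (\<lambda>p. step j (fst p) (snd p)) \<in> borel_measurable (borel \<Otimes>\<^sub>M fresh)"
    and e: "\<And>j. (\<lambda>p. e j (fst p) (snd p)) \<in> borel_measurable (borel \<Otimes>\<^sub>M fresh)"
      "\<And>j x z. e j x z > 0" "\<And>j x s q q'. e j x (s, q) = e j x (s, q')"
  shows "measure (run_space D R) {\<omega> \<in> space (run_space D R).
    \<forall>j\<in>{1..N}. (trajectory x\<^sub>0 step \<omega> j, \<omega> j) \<in> accurate_set j \<inter> pca_set e j} \<ge> 1 - 3 * \<delta>"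
proof -
  have "measure fresh {z \<in> space fresh. (x, z) \<in> accurate_set j \<inter> pca_set e j} \<ge> 1 - 2 * \<delta>'"
    if j: "j \<ge> 1" for j x
  proof -
    note [measurable] = accurate_set(1)[OF j] pca_set(1)[where e = e, OF j e]
    let ?P = "{z \<in> space fresh. (x, z) \<in> accurate_set j}" and ?Q = "{z \<in> space fresh. (x, z) \<in> pca_set e j}"
    have "measure fresh (?P \<union> ?Q) = measure fresh ?P + measure fresh ?Q - measure fresh (?P \<inter> ?Q)"
      by (rule measure_Un3) (auto simp: fresh.P.fmeasurable_eq_sets)
    moreover have "?P \<inter> ?Q = {z \<in> space fresh. (x, z) \<in> accurate_set j \<inter> pca_set e j}" by blast
    ultimately show ?thesis
      using accurate_set(2)[OF j, of x] pca_set(2)[where e = e, OF j e, of x] fresh.P.prob_le_1[of "?P \<union> ?Q"]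
      by simp
  qed
  then have "measure (run_space D R) {\<omega> \<in> space (run_space D R).
    \<forall>j\<in>{1..N}. (trajectory x\<^sub>0 step \<omega> j, \<omega> j) \<in> accurate_set j \<inter> pca_set e j} \<ge> 1 - real N * (2 * \<delta>')"
    using assms(1) accurate_set(1) pca_set(1)[where e = e, OF _ e]
    by (intro run.prob_trajectory_ge[where N = borel] sets.Int) (auto simp: case_prod_beta)
  then show ?thesis using \<delta>'_bounds(3) \<delta>(1) by linarith
qed

section \<open>The two algorithms as trajectories\<close>

abbreviation "step1 \<alpha> j x z \<equiv> fst (ncg_s A j x (acc1 A \<alpha> j x z) z)"

abbreviation "step2 j x z \<equiv>
  if sg_cond A j x z then x - (1 / L\<^sub>1) *\<^sub>R stoch_grad A j x z else fst (ncg_s A j x (\<epsilon>\<^sub>2 / 2) z)"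

lemma sncg1_iter_eq: "sncg1_iter A \<alpha> \<omega> j = trajectory x\<^sub>0 (step1 \<alpha>) \<omega> j"
  by (induction j) (auto simp: Let_def)

lemma sncg2_iter_eq: "sncg2_iter A \<omega> j = trajectory x\<^sub>0 step2 \<omega> j"
  by (induction j) (auto simp: Let_def)

lemma acc1_pos: "acc1 A \<alpha> j x z > 0"
  using pos by (simp add: acc1_def)

lemma acc1_dep: "acc1 A \<alpha> j x (s, q) = acc1 A \<alpha> j x (s, q')"
  by (simp add: acc1_def stoch_grad_def)

lemma measurable_acc1[measurable]:
  "(\<lambda>p. acc1 A \<alpha> j (fst p) (snd p)) \<in> borel_measurable (borel \<Otimes>\<^sub>M fresh)"
  unfolding acc1_def by measurable

lemma measurable_step1:
  assumes "j \<ge> 1"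
  shows "(\<lambda>p. step1 \<alpha> j (fst p) (snd p)) \<in> borel_measurable (borel \<Otimes>\<^sub>M fresh)"
  using measurable_ncg_s(1)[OF assms measurable_acc1] .

lemma pred_sg_cond[measurable]: "Measurable.pred (borel \<Otimes>\<^sub>M fresh) (\<lambda>p. sg_cond A j (fst p) (snd p))"
  unfolding sg_cond_def by measurable

lemma measurable_step2:
  assumes "j \<ge> 1"
  shows "(\<lambda>p. step2 j (fst p) (snd p)) \<in> borel_measurable (borel \<Otimes>\<^sub>M fresh)"
proof -
  note [measurable] = measurable_ncg_s(1)[OF assms, of "\<lambda>_. \<epsilon>\<^sub>2 / 2"]
  show ?thesis by measurable
qed

lemma pred_sncg1_stops:
  assumes "j \<ge> 1"
  shows "Measurable.pred (run_space D R) (\<lambda>\<omega>. sncg1_stops A \<alpha> \<omega> j)"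
proof -
  note [measurable] = measurable_ncg_s(2)[OF assms measurable_acc1]
  have "Measurable.pred (borel \<Otimes>\<^sub>M fresh) (\<lambda>p.
      snd (ncg_s A j (fst p) (acc1 A \<alpha> j (fst p) (snd p)) (snd p)) > - \<epsilon>\<^sub>2 / 2 \<and>
      norm (stoch_grad A j (fst p) (snd p)) \<le> \<epsilon>\<^sub>1)"
    by measurable
  from measurable_compose[OF measurable_trajectory_pair[OF measurable_step1] this]
  show ?thesis by (simp add: sncg1_stops_def Let_def sncg1_iter_eq)
qed

lemma pred_sncg2_sg_cond:
  "Measurable.pred (run_space D R) (\<lambda>\<omega>. sg_cond A j (sncg2_iter A \<omega> j) (\<omega> j))"
  using measurable_compose[OF measurable_trajectory_pair[OF measurable_step2] pred_sg_cond]
  by (simp add: sncg2_iter_eq)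

lemma pred_sncg2_stops:
  assumes "j \<ge> 1"
  shows "Measurable.pred (run_space D R) (\<lambda>\<omega>. sncg2_stops A \<omega> j)"
proof -
  note [measurable] = measurable_ncg_s(2)[OF assms, of "\<lambda>_. \<epsilon>\<^sub>2 / 2"]
  have "Measurable.pred (borel \<Otimes>\<^sub>M fresh) (\<lambda>p. \<not> sg_cond A j (fst p) (snd p) \<and>
      snd (ncg_s A j (fst p) (\<epsilon>\<^sub>2 / 2) (snd p)) > - \<epsilon>\<^sub>2 / 2)"
    by measurable
  from measurable_compose[OF measurable_trajectory_pair[OF measurable_step2] this]
  show ?thesis by (simp add: sncg2_stops_def Let_def sncg2_iter_eq)
qed

lemma pred_stationary:
  assumes "X \<in> borel_measurable M"
  shows "Measurable.pred M (\<lambda>\<omega>. norm (gradient f (X \<omega>)) \<le> 2 * \<epsilon>\<^sub>1 \<and> lambda_min (hessian f (X \<omega>)) \<ge> - 2 * \<epsilon>\<^sub>2)"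
proof -
  have [measurable]: "(\<lambda>x. lambda_min (hessian f x)) \<in> borel_measurable borel"
    using transpose_hessian[OF f_smooth(1)] by (intro borel_measurable_lambda_min) auto
  have "Measurable.pred borel (\<lambda>x. norm (gradient f x) \<le> 2 * \<epsilon>\<^sub>1 \<and> lambda_min (hessian f x) \<ge> - 2 * \<epsilon>\<^sub>2)"
    by measurable
  from measurable_compose[OF assms this] show ?thesis .
qed

lemma measurable_sncg1_iter: "(\<lambda>\<omega>. sncg1_iter A \<alpha> \<omega> j) \<in> borel_measurable (run_space D R)"
  using measurable_compose[OF measurable_trajectory_pair[OF measurable_step1] measurable_fst]
  by (simp add: sncg1_iter_eq)

lemma measurable_sncg2_iter: "(\<lambda>\<omega>. sncg2_iter A \<omega> j) \<in> borel_measurable (run_space D R)"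
  using measurable_compose[OF measurable_trajectory_pair[OF measurable_step2] measurable_fst]
  by (simp add: sncg2_iter_eq)

section \<open>Deterministic analysis on the good event\<close>

lemma sncg1_decrease:
  assumes j: "j \<ge> 1" and acc: "(sncg1_iter A \<alpha> \<omega> j, \<omega> j) \<in> accurate_set j"
    and run: "\<not> sncg1_stops A \<alpha> \<omega> j"
  shows "f (sncg1_iter A \<alpha> \<omega> (Suc j)) \<le> f (sncg1_iter A \<alpha> \<omega> j) - 1 / K"
proof -
  let ?x = "sncg1_iter A \<alpha> \<omega> j"
  let ?\<epsilon> = "acc1 A \<alpha> j ?x (\<omega> j)"
  have next_iter: "sncg1_iter A \<alpha> \<omega> (Suc j) = fst (ncg_s A j ?x ?\<epsilon> (\<omega> j))"
    using j by (simp add: Let_def)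
  consider "snd (ncg_s A j ?x ?\<epsilon> (\<omega> j)) \<le> - \<epsilon>\<^sub>2 / 2" | "norm (stoch_grad A j ?x (\<omega> j)) \<ge> \<epsilon>\<^sub>1"
    using run unfolding sncg1_stops_def Let_def A_simps by linarith
  then show ?thesis
  proof cases
    case 1
    then show ?thesis
      using ncg_decrease_curvature[OF j acc acc1_pos] inverse_K_le(1) unfolding next_iter by fastforce
  next
    case 2
    then show ?thesis
      using ncg_decrease[OF j acc acc1_pos, of \<alpha> j ?x "\<omega> j"] large_gradient_decrease[OF 2] inverse_K_le(2)
      unfolding next_iter by linarith
  qed
qed

lemma sncg1_terminates:
  assumes "\<forall>j\<in>{1..N}. (sncg1_iter A \<alpha> \<omega> j, \<omega> j) \<in> accurate_set j"
  shows "terminates (sncg1_stops A \<alpha> \<omega>)" "stop_index (sncg1_stops A \<alpha> \<omega>) \<le> N"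
proof -
  have "sncg1_iter A \<alpha> \<omega> 1 = x\<^sub>0" by (simp add: Let_def)
  moreover have "f (sncg1_iter A \<alpha> \<omega> (Suc j)) \<le> f (sncg1_iter A \<alpha> \<omega> j) - 1 / K"
    if "1 \<le> j" "j \<le> N" "\<not> sncg1_stops A \<alpha> \<omega> j" for j
    using assms that by (intro sncg1_decrease) auto
  ultimately show "terminates (sncg1_stops A \<alpha> \<omega>)" "stop_index (sncg1_stops A \<alpha> \<omega>) \<le> N"
    by (rule terminates_within_N; blast)+
qed

text \<open>The guarantee is kept separate for each kind of step, since the two kinds are counted
  against \<open>\<Delta>\<close> separately.\<close>

abbreviation "decrease2 \<omega> j \<equiv>
  if sg_cond A j (sncg2_iter A \<omega> j) (\<omega> j) then \<epsilon>\<^sub>1\<^sup>2 / (8 * L\<^sub>1) else \<epsilon>\<^sub>2 ^ 3 / (48 * L\<^sub>2\<^sup>2)"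

lemma sncg2_decrease:
  assumes j: "j \<ge> 1" and acc: "(sncg2_iter A \<omega> j, \<omega> j) \<in> accurate_set j"
    and run: "\<not> sncg2_stops A \<omega> j"
  shows "f (sncg2_iter A \<omega> (Suc j)) \<le> f (sncg2_iter A \<omega> j) - decrease2 \<omega> j"
proof (cases "sg_cond A j (sncg2_iter A \<omega> j) (\<omega> j)")
  case True
  then have "sncg2_iter A \<omega> (Suc j) = sncg2_iter A \<omega> j - (1 / L\<^sub>1) *\<^sub>R stoch_grad A j (sncg2_iter A \<omega> j) (\<omega> j)"
    using j by (simp add: Let_def)
  moreover have "norm (stoch_grad A j (sncg2_iter A \<omega> j) (\<omega> j)) \<ge> \<epsilon>\<^sub>1"
    using True by (simp add: sg_cond_def)
  ultimately show ?thesis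
    using sg_decrease[OF acc] large_gradient_decrease True by fastforce
next
  case False
  then have "sncg2_iter A \<omega> (Suc j) = fst (ncg_s A j (sncg2_iter A \<omega> j) (\<epsilon>\<^sub>2 / 2) (\<omega> j))"
    using j by (simp add: Let_def)
  moreover have "snd (ncg_s A j (sncg2_iter A \<omega> j) (\<epsilon>\<^sub>2 / 2) (\<omega> j)) \<le> - \<epsilon>\<^sub>2 / 2"
    using run False by (simp add: sncg2_stops_def Let_def)
  ultimately show ?thesis
    using ncg_decrease_curvature[OF j acc, of "\<epsilon>\<^sub>2 / 2"] False pos by simp
qed

lemma sncg2_terminates:
  assumes "\<forall>j\<in>{1..N}. (sncg2_iter A \<omega> j, \<omega> j) \<in> accurate_set j"
  shows "terminates (sncg2_stops A \<omega>)" "stop_index (sncg2_stops A \<omega>) \<le> N"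
proof -
  have "sncg2_iter A \<omega> 1 = x\<^sub>0" by (simp add: Let_def)
  moreover have "f (sncg2_iter A \<omega> (Suc j)) \<le> f (sncg2_iter A \<omega> j) - 1 / K"
    if "1 \<le> j" "j \<le> N" "\<not> sncg2_stops A \<omega> j" for j
  proof -
    have "f (sncg2_iter A \<omega> (Suc j)) \<le> f (sncg2_iter A \<omega> j) - decrease2 \<omega> j"
      using assms that by (intro sncg2_decrease) auto
    moreover have "1 / K \<le> decrease2 \<omega> j" using inverse_K_le by simp
    ultimately show ?thesis by linarith
  qed
  ultimately show "terminates (sncg2_stops A \<omega>)" "stop_index (sncg2_stops A \<omega>) \<le> N"
    by (rule terminates_within_N; blast)+
qed

text \<open>The guaranteed decreases before the stopping iteration sum to at most
  \<open>\<Delta>\<close>, and each kind of step contributes a nonnegative share. The stopping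
  iteration is always an NCG-S step and is credited with no decrease: it is the extra 1 in the
  second count.\<close>

lemma sncg2_step_counts:
  assumes acc: "\<forall>j\<in>{1..N}. (sncg2_iter A \<omega> j, \<omega> j) \<in> accurate_set j"
  shows "real (card (sncg2_sg_steps A \<omega>)) \<le> 8 * L\<^sub>1 / \<epsilon>\<^sub>1\<^sup>2 * \<Delta>"
    and "real (card (sncg2_ncg_steps A \<omega>)) \<le> 1 + 48 * L\<^sub>2\<^sup>2 / \<epsilon>\<^sub>2 ^ 3 * \<Delta>"
proof -
  let ?J = "stop_index (sncg2_stops A \<omega>)"
  let ?sg = "\<lambda>j. sg_cond A j (sncg2_iter A \<omega> j) (\<omega> j)"
  note J = executed_eq_atLeastAtMost[OF sncg2_terminates(1)[OF acc]] sncg2_terminates(2)[OF acc]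
  have J_ncg: "\<not> ?sg ?J" using J(3) by (simp add: sncg2_stops_def Let_def)
  let ?S = "{j \<in> {1..<?J}. ?sg j}" and ?T = "{j \<in> {1..<?J}. \<not> ?sg j}"
  have "sncg2_sg_steps A \<omega> = {j. executed (sncg2_stops A \<omega>) j} \<inter> {j. ?sg j}"
    by (auto simp: sncg2_sg_steps_def)
  also have "\<dots> = ?S" unfolding J(1) using J_ncg by (auto simp: le_less)
  finally have S: "sncg2_sg_steps A \<omega> = ?S" .
  have "sncg2_ncg_steps A \<omega> = {j. executed (sncg2_stops A \<omega>) j} \<inter> {j. \<not> ?sg j}"
    by (auto simp: sncg2_ncg_steps_def)
  also have "\<dots> = insert ?J ?T" unfolding J(1) using J_ncg J(2) by auto
  finally have T: "sncg2_ncg_steps A \<omega> = insert ?J ?T" .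
  have "f (sncg2_iter A \<omega> ?J) + sum (decrease2 \<omega>) {1..<?J} \<le> f (sncg2_iter A \<omega> 1)"
  proof (rule sum_decrease_le)
    fix j assume "1 \<le> j" "j < ?J"
    then show "f (sncg2_iter A \<omega> (Suc j)) \<le> f (sncg2_iter A \<omega> j) - decrease2 \<omega> j"
      using acc J(4,5) by (intro sncg2_decrease) auto
  qed (rule J(2))
  then have "sum (decrease2 \<omega>) {1..<?J} \<le> \<Delta>"
    using gap(1)[of "sncg2_iter A \<omega> ?J"] gap(2) by (simp add: Let_def)
  moreover have "sum (decrease2 \<omega>) {1..<?J} = real (card ?S) * (\<epsilon>\<^sub>1\<^sup>2 / (8 * L\<^sub>1)) + real (card ?T) * (\<epsilon>\<^sub>2 ^ 3 / (48 * L\<^sub>2\<^sup>2))"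
    by (subst sum.If_cases) (simp_all add: Int_def)
  moreover have "0 \<le> real (card ?S) * (\<epsilon>\<^sub>1\<^sup>2 / (8 * L\<^sub>1))" "0 \<le> real (card ?T) * (\<epsilon>\<^sub>2 ^ 3 / (48 * L\<^sub>2\<^sup>2))"
    using pos by simp_all
  ultimately have le: "real (card ?S) * (\<epsilon>\<^sub>1\<^sup>2 / (8 * L\<^sub>1)) \<le> \<Delta>" "real (card ?T) * (\<epsilon>\<^sub>2 ^ 3 / (48 * L\<^sub>2\<^sup>2)) \<le> \<Delta>"
    by linarith+
  show "real (card (sncg2_sg_steps A \<omega>)) \<le> 8 * L\<^sub>1 / \<epsilon>\<^sub>1\<^sup>2 * \<Delta>"
    using le(1) pos unfolding S by (simp add: field_simps)
  show "real (card (sncg2_ncg_steps A \<omega>)) \<le> 1 + 48 * L\<^sub>2\<^sup>2 / \<epsilon>\<^sub>2 ^ 3 * \<Delta>"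
    using le(2) pos unfolding T by (simp add: field_simps)
qed

lemma sncg1_output:
  assumes good: "\<forall>j\<in>{1..N}. (sncg1_iter A \<alpha> \<omega> j, \<omega> j) \<in> accurate_set j \<inter> pca_set (acc1 A \<alpha>) j"
    and \<alpha>: "0 < \<alpha>" "\<epsilon>\<^sub>2 = \<epsilon>\<^sub>1 powr \<alpha>"
  defines "x \<equiv> sncg1_iter A \<alpha> \<omega> (stop_index (sncg1_stops A \<alpha> \<omega>))"
  shows "norm (gradient f x) \<le> 2 * \<epsilon>\<^sub>1" "lambda_min (hessian f x) \<ge> - 2 * \<epsilon>\<^sub>2"
proof -
  let ?J = "stop_index (sncg1_stops A \<alpha> \<omega>)"
  have stopped: "terminates (sncg1_stops A \<alpha> \<omega>)" "?J \<le> N"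
    using good by (intro sncg1_terminates; blast)+
  note J = executed_eq_atLeastAtMost[OF stopped(1)]
  have acc: "(x, \<omega> ?J) \<in> accurate_set ?J" and pca: "(x, \<omega> ?J) \<in> pca_set (acc1 A \<alpha>) ?J"
    using good J(2) stopped(2) by (auto simp: x_def)
  have stop: "snd (ncg_s A ?J x (acc1 A \<alpha> ?J x (\<omega> ?J)) (\<omega> ?J)) > - \<epsilon>\<^sub>2 / 2"
    "norm (stoch_grad A ?J x (\<omega> ?J)) \<le> \<epsilon>\<^sub>1"
    using J(3) by (auto simp: sncg1_stops_def Let_def x_def)
  show "norm (gradient f x) \<le> 2 * \<epsilon>\<^sub>1" using norm_gradient_le[OF acc stop(2)] .
  \<comment> \<open>At the stopping iteration the gradient test collapses the adaptive accuracy to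
    \<open>\<epsilon>\<^sub>2 / 2\<close>, by the relation between \<open>\<epsilon>\<^sub>1\<close>
    and \<open>\<epsilon>\<^sub>2\<close>.\<close>
  have "norm (stoch_grad A ?J x (\<omega> ?J)) powr \<alpha> \<le> \<epsilon>\<^sub>2"
    using stop(2) \<alpha> by (simp add: powr_mono2)
  then have "acc1 A \<alpha> ?J x (\<omega> ?J) \<le> \<epsilon>\<^sub>2 / 2" by (simp add: acc1_def)
  then show "lambda_min (hessian f x) \<ge> - 2 * \<epsilon>\<^sub>2"
    using lambda_min_hessian_ge[OF J(2) acc pca] stop(1) by simp
qed

lemma sncg2_output:
  assumes good: "\<forall>j\<in>{1..N}. (sncg2_iter A \<omega> j, \<omega> j) \<in> accurate_set j \<inter> pca_set (\<lambda>_ _ _. \<epsilon>\<^sub>2 / 2) j"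
  defines "x \<equiv> sncg2_iter A \<omega> (stop_index (sncg2_stops A \<omega>))"
  shows "norm (gradient f x) \<le> 2 * \<epsilon>\<^sub>1" "lambda_min (hessian f x) \<ge> - 2 * \<epsilon>\<^sub>2"
proof -
  let ?J = "stop_index (sncg2_stops A \<omega>)"
  have stopped: "terminates (sncg2_stops A \<omega>)" "?J \<le> N"
    using good by (intro sncg2_terminates; blast)+
  note J = executed_eq_atLeastAtMost[OF stopped(1)]
  have acc: "(x, \<omega> ?J) \<in> accurate_set ?J" and pca: "(x, \<omega> ?J) \<in> pca_set (\<lambda>_ _ _. \<epsilon>\<^sub>2 / 2) ?J"
    using good J(2) stopped(2) by (auto simp: x_def)
  have stop: "snd (ncg_s A ?J x (\<epsilon>\<^sub>2 / 2) (\<omega> ?J)) > - \<epsilon>\<^sub>2 / 2" "norm (stoch_grad A ?J x (\<omega> ?J)) \<le> \<epsilon>\<^sub>1"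
    using J(3) by (auto simp: sncg2_stops_def sg_cond_def Let_def x_def)
  show "norm (gradient f x) \<le> 2 * \<epsilon>\<^sub>1" using norm_gradient_le[OF acc stop(2)] .
  show "lambda_min (hessian f x) \<ge> - 2 * \<epsilon>\<^sub>2"
    using lambda_min_hessian_ge[OF J(2) acc pca] stop(1) by simp
qed

section \<open>Probability and time bounds for whole runs\<close>

text \<open>The event of accurate samples in the first \<open>N\<close> iterations is contained in
  the claimed one. Monotonicity of the measure then requires the claimed event to be
  measurable.\<close>

lemma prob_sncg1_steps:
  "measure (run_space D R) {\<omega> \<in> space (run_space D R). terminates (sncg1_stops A \<alpha> \<omega>) \<and>
     real (card (sncg1_ncg_steps A \<alpha> \<omega>)) \<le> 1 + K * \<Delta>} \<ge> 1 - \<delta>"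
proof (rule order_trans[OF prob_trajectory_accurate[OF measurable_step1[of _ \<alpha>]] run.P.finite_measure_mono])
  show "{\<omega> \<in> space (run_space D R). \<forall>j\<in>{1..N}. (trajectory x\<^sub>0 (step1 \<alpha>) \<omega> j, \<omega> j) \<in> accurate_set j}
    \<subseteq> {\<omega> \<in> space (run_space D R). terminates (sncg1_stops A \<alpha> \<omega>) \<and>
     real (card (sncg1_ncg_steps A \<alpha> \<omega>)) \<le> 1 + K * \<Delta>}"
  proof safe
    fix \<omega> assume "\<forall>j\<in>{1..N}. (trajectory x\<^sub>0 (step1 \<alpha>) \<omega> j, \<omega> j) \<in> accurate_set j"
    then have acc: "\<forall>j\<in>{1..N}. (sncg1_iter A \<alpha> \<omega> j, \<omega> j) \<in> accurate_set j"
      by (simp add: sncg1_iter_eq)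
    note T = sncg1_terminates[OF acc]
    show "terminates (sncg1_stops A \<alpha> \<omega>)" by (fact T)
    have "card (sncg1_ncg_steps A \<alpha> \<omega>) \<le> N"
      using T(2) by (simp add: sncg1_ncg_steps_def executed_eq_atLeastAtMost(1)[OF T(1)])
    then show "real (card (sncg1_ncg_steps A \<alpha> \<omega>)) \<le> 1 + K * \<Delta>"
      using N_bounds(1) by linarith
  qed
  have [measurable]: "(\<lambda>\<omega>. real (card (sncg1_ncg_steps A \<alpha> \<omega>))) \<in> borel_measurable (run_space D R)"
    using measurable_card_executed[OF pred_sncg1_stops, where P = "\<lambda>_ _. True"]
    by (simp add: sncg1_ncg_steps_def)
  note [measurable] = pred_terminates[OF pred_sncg1_stops]
  show "{\<omega> \<in> space (run_space D R). terminates (sncg1_stops A \<alpha> \<omega>) \<and>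
     real (card (sncg1_ncg_steps A \<alpha> \<omega>)) \<le> 1 + K * \<Delta>} \<in> sets (run_space D R)"
    by measurable
qed

lemma prob_sncg2_steps:
  "measure (run_space D R) {\<omega> \<in> space (run_space D R). terminates (sncg2_stops A \<omega>) \<and>
     real (card (sncg2_sg_steps A \<omega>)) \<le> 8 * L\<^sub>1 / \<epsilon>\<^sub>1\<^sup>2 * \<Delta> \<and>
     real (card (sncg2_ncg_steps A \<omega>)) \<le> 1 + 48 * L\<^sub>2\<^sup>2 / \<epsilon>\<^sub>2 ^ 3 * \<Delta>} \<ge> 1 - \<delta>" (is "measure _ ?E \<ge> _")
proof (rule order_trans[OF prob_trajectory_accurate[OF measurable_step2] run.P.finite_measure_mono])
  show "{\<omega> \<in> space (run_space D R). \<forall>j\<in>{1..N}. (trajectory x\<^sub>0 step2 \<omega> j, \<omega> j) \<in> accurate_set j} \<subseteq> ?E"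
    using sncg2_terminates(1) sncg2_step_counts unfolding sncg2_iter_eq[symmetric] by blast
  have [measurable]: "(\<lambda>\<omega>. real (card (sncg2_sg_steps A \<omega>))) \<in> borel_measurable (run_space D R)"
    "(\<lambda>\<omega>. real (card (sncg2_ncg_steps A \<omega>))) \<in> borel_measurable (run_space D R)"
    unfolding sncg2_sg_steps_def sncg2_ncg_steps_def
    by (intro measurable_card_executed pred_sncg2_stops pred_sncg2_sg_cond pred_intros_logic; assumption)+
  note [measurable] = pred_terminates[OF pred_sncg2_stops]
  show "?E \<in> sets (run_space D R)" by measurable
qed

lemma prob_sncg1_output:
  assumes "0 < \<alpha>" "\<epsilon>\<^sub>2 = \<epsilon>\<^sub>1 powr \<alpha>"
  shows "measure (run_space D R) {\<omega> \<in> space (run_space D R). terminates (sncg1_stops A \<alpha> \<omega>) \<and>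
     norm (gradient f (sncg1_iter A \<alpha> \<omega> (stop_index (sncg1_stops A \<alpha> \<omega>)))) \<le> 2 * \<epsilon>\<^sub>1 \<and>
     lambda_min (hessian f (sncg1_iter A \<alpha> \<omega> (stop_index (sncg1_stops A \<alpha> \<omega>)))) \<ge> - 2 * \<epsilon>\<^sub>2} \<ge> 1 - 3 * \<delta>"
    (is "measure _ ?E \<ge> _")
proof (rule order_trans[OF prob_trajectory_accurate_pca[OF measurable_step1[of _ \<alpha>] measurable_acc1 acc1_pos acc1_dep]
      run.P.finite_measure_mono])
  show "{\<omega> \<in> space (run_space D R). \<forall>j\<in>{1..N}. (trajectory x\<^sub>0 (step1 \<alpha>) \<omega> j, \<omega> j) \<in> accurate_set j \<inter> pca_set (acc1 A \<alpha>) j} \<subseteq> ?E"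
    using sncg1_terminates(1) sncg1_output[OF _ assms] unfolding sncg1_iter_eq[symmetric] by blast
  note [measurable] = pred_terminates[OF pred_sncg1_stops]
    pred_stop_index[OF pred_sncg1_stops pred_stationary[OF measurable_sncg1_iter]]
  show "?E \<in> sets (run_space D R)" by measurable
qed

lemma prob_sncg2_output:
  "measure (run_space D R) {\<omega> \<in> space (run_space D R). terminates (sncg2_stops A \<omega>) \<and>
     norm (gradient f (sncg2_iter A \<omega> (stop_index (sncg2_stops A \<omega>)))) \<le> 2 * \<epsilon>\<^sub>1 \<and>
     lambda_min (hessian f (sncg2_iter A \<omega> (stop_index (sncg2_stops A \<omega>)))) \<ge> - 2 * \<epsilon>\<^sub>2} \<ge> 1 - 3 * \<delta>"
    (is "measure _ ?E \<ge> _")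
proof -
  have "1 - 3 * \<delta> \<le> measure (run_space D R) {\<omega> \<in> space (run_space D R).
      \<forall>j\<in>{1..N}. (trajectory x\<^sub>0 step2 \<omega> j, \<omega> j) \<in> accurate_set j \<inter> pca_set (\<lambda>_ _ _. \<epsilon>\<^sub>2 / 2) j}"
    using pos by (intro prob_trajectory_accurate_pca measurable_step2) auto
  also have "\<dots> \<le> measure (run_space D R) ?E"
  proof (rule run.P.finite_measure_mono)
    show "{\<omega> \<in> space (run_space D R). \<forall>j\<in>{1..N}. (trajectory x\<^sub>0 step2 \<omega> j, \<omega> j) \<in> accurate_set j \<inter> pca_set (\<lambda>_ _ _. \<epsilon>\<^sub>2 / 2) j} \<subseteq> ?E"
      using sncg2_terminates(1) sncg2_output unfolding sncg2_iter_eq[symmetric] by blast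
    note [measurable] = pred_terminates[OF pred_sncg2_stops]
      pred_stop_index[OF pred_sncg2_stops pred_stationary[OF measurable_sncg2_iter]]
    show "?E \<in> sets (run_space D R)" by measurable
  qed
  finally show ?thesis .
qed

lemma sncg1_time:
  assumes "\<omega> \<in> space (run_space D R)" "j \<in> sncg1_ncg_steps A \<alpha> \<omega>"
  defines "x \<equiv> sncg1_iter A \<alpha> \<omega> j"
  defines "\<epsilon> \<equiv> acc1 A \<alpha> j x (\<omega> j)"
  shows "soft_O_bound (2 * C + 1) k CARD('n) \<delta>' \<epsilon> (ncg_s_time T\<^sub>g T\<^sub>h pca_time A j x \<epsilon> (\<omega> j))
    (T\<^sub>h * real (b\<^sub>2 j)
     + T\<^sub>h * real (b\<^sub>2 j) powr (3/4)
         * (sqrt L\<^sub>1 / max \<epsilon>\<^sub>2 (norm (stoch_grad A j x (\<omega> j)) powr \<alpha>) powr (1/2))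
     + real (b\<^sub>1 j) * T\<^sub>g)"
proof -
  have "j \<ge> 1" using assms(2) by (simp add: sncg1_ncg_steps_def executed_def)
  moreover have "max \<epsilon>\<^sub>2 (norm (stoch_grad A j x (\<omega> j)) powr \<alpha>) = 2 * \<epsilon>"
    by (simp add: \<epsilon>_def acc1_def)
  ultimately show ?thesis
    using soft_O_bound_ncg_s_time[OF _ space_runD[OF assms(1)], where j = j and \<epsilon> = \<epsilon> and x = x] acc1_pos by (simp add: \<epsilon>_def)
qed

lemma sncg2_time:
  assumes "\<omega> \<in> space (run_space D R)" "j \<in> sncg2_ncg_steps A \<omega>"
  shows "soft_O_bound (2 * C + 1) k CARD('n) \<delta>' (\<epsilon>\<^sub>2 / 2)
    (ncg_s_time T\<^sub>g T\<^sub>h pca_time A j (sncg2_iter A \<omega> j) (\<epsilon>\<^sub>2 / 2) (\<omega> j))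
    (T\<^sub>h * real (b\<^sub>2 j) + T\<^sub>h * real (b\<^sub>2 j) powr (3/4) * (sqrt L\<^sub>1 / \<epsilon>\<^sub>2 powr (1/2)) + real (b\<^sub>1 j) * T\<^sub>g)"
proof -
  have "j \<ge> 1" using assms(2) by (simp add: sncg2_ncg_steps_def executed_def)
  then show ?thesis
    using soft_O_bound_ncg_s_time[OF _ space_runD[OF assms(1)], where j = j and \<epsilon> = "\<epsilon>\<^sub>2 / 2"] pos by simp
qed

end

theorem theorem1:
  fixes D :: "'a measure" and R :: "'s measure"
    and F :: "real^'n \<Rightarrow> 'a \<Rightarrow> real" and f :: "real^'n \<Rightarrow> real"
    and x\<^sub>0 x_star :: "real^'n"
    and L\<^sub>1 L\<^sub>2 \<Delta> G \<epsilon>\<^sub>1 \<epsilon>\<^sub>2 \<epsilon>\<^sub>3 \<epsilon>\<^sub>4 \<delta> \<delta>' T\<^sub>g T\<^sub>h C :: real and k :: nat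
    and b\<^sub>1 b\<^sub>2 :: "nat \<Rightarrow> nat"
    and pca :: "(real^'n^'n) list \<Rightarrow> real \<Rightarrow> 's \<Rightarrow> real^'n"
    and pca_time :: "(real^'n^'n) list \<Rightarrow> real \<Rightarrow> 's \<Rightarrow> real"
    and A :: "('a, 's, 'n) sncg"
  assumes "prob_space D" and "prob_space R"
    and f_def: "\<And>x. integrable D (F x)" "\<And>x. f x = (\<integral>\<xi>. F x \<xi> \<partial>D)"
    and pos: "L\<^sub>1 > 0" "L\<^sub>2 > 0" "G > 0" "\<epsilon>\<^sub>1 > 0" "\<epsilon>\<^sub>2 > 0" "\<epsilon>\<^sub>3 > 0" "\<epsilon>\<^sub>4 > 0"
    and cost_pos: "T\<^sub>g > 0" "T\<^sub>h > 0" "C > 0"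
    and \<delta>: "0 < \<delta>" "\<delta> < 1"
    and assm_i: "\<And>\<xi>. \<xi> \<in> space D \<Longrightarrow> twice_differentiable (\<lambda>x. F x \<xi>)"
      "\<And>\<xi> x y. \<xi> \<in> space D \<Longrightarrow>
         norm (gradient (\<lambda>x. F x \<xi>) x - gradient (\<lambda>x. F x \<xi>) y) \<le> L\<^sub>1 * norm (x - y)"
    and assm_ii: "twice_differentiable f"
      "\<And>x y. spectral_norm (hessian f x - hessian f y) \<le> L\<^sub>2 * norm (x - y)"
    and assm_iii: "\<And>x. f x_star \<le> f x" "f x\<^sub>0 - f x_star \<le> \<Delta>"
    and assm_iv: "\<And>x. integrable D (\<lambda>\<xi>. exp (norm (gradient (\<lambda>y. F y \<xi>) x - gradient f x) / G))"
      "\<And>x. (\<integral>\<xi>. exp (norm (gradient (\<lambda>y. F y \<xi>) x - gradient f x) / G) \<partial>D) \<le> exp 1"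
    and \<epsilon>\<^sub>3_le: "\<epsilon>\<^sub>3 \<le> \<epsilon>\<^sub>2 / 24"
    and \<epsilon>\<^sub>4_le: "\<epsilon>\<^sub>4 \<le> min (1 / (2 * sqrt 2) * \<epsilon>\<^sub>1) (\<epsilon>\<^sub>2\<^sup>2 / (24 * L\<^sub>2))"
    and \<delta>'_def: "\<delta>' = \<delta> / (1 + max (48 * L\<^sub>2\<^sup>2 / \<epsilon>\<^sub>2 ^ 3) (8 * L\<^sub>1 / \<epsilon>\<^sub>1\<^sup>2) * \<Delta>)"
    and A_def: "A = \<lparr>loss = F, size1 = b\<^sub>1, size2 = b\<^sub>2, routine = pca,
                  Lip1 = L\<^sub>1, Lip2 = L\<^sub>2, eps1 = \<epsilon>\<^sub>1, eps2 = \<epsilon>\<^sub>2, start = x\<^sub>0\<rparr>"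
    and batch\<^sub>1: "\<And>j. j \<ge> 1 \<Longrightarrow> real (b\<^sub>1 j) \<ge> 4 * G\<^sup>2 * (1 + 3 * (ln (1 / \<delta>'))\<^sup>2) / \<epsilon>\<^sub>4\<^sup>2"
    and batch\<^sub>2: "\<And>j. j \<ge> 1 \<Longrightarrow> real (b\<^sub>2 j) \<ge> 16 * L\<^sub>1\<^sup>2 / \<epsilon>\<^sub>3\<^sup>2 * ln (2 * real CARD('n) / \<delta>')"
    and accurate: "\<And>j x. j \<ge> 1 \<Longrightarrow>
      measure (fresh_space D R) {z \<in> space (fresh_space D R).
        norm (stoch_grad A j x z - gradient f x) \<le> \<epsilon>\<^sub>4 \<and>
        spectral_norm (stoch_hess A j x z - hessian f x) \<le> \<epsilon>\<^sub>3} \<ge> 1 - \<delta>'"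
    and approx_pca: "approx_pca R L\<^sub>1 \<delta>' T\<^sub>h C k pca pca_time"
  shows
    "(\<forall>\<alpha>. 0 < \<alpha> \<and> \<alpha> \<le> 1 \<and> \<epsilon>\<^sub>2 = \<epsilon>\<^sub>1 powr \<alpha> \<longrightarrow>
        measure (run_space D R) {\<omega> \<in> space (run_space D R).
          terminates (sncg1_stops A \<alpha> \<omega>) \<and>
          real (card (sncg1_ncg_steps A \<alpha> \<omega>))
            \<le> 1 + max (48 * L\<^sub>2\<^sup>2 / \<epsilon>\<^sub>2 ^ 3) (8 * L\<^sub>1 / \<epsilon>\<^sub>1\<^sup>2) * \<Delta>} \<ge> 1 - \<delta> \<and>
        (\<forall>\<omega>\<in>space (run_space D R). \<forall>j\<in>sncg1_ncg_steps A \<alpha> \<omega>.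
          let x = sncg1_iter A \<alpha> \<omega> j; \<epsilon> = acc1 A \<alpha> j x (\<omega> j)
          in soft_O_bound (2 * C + 1) k CARD('n) \<delta>' \<epsilon>
               (ncg_s_time T\<^sub>g T\<^sub>h pca_time A j x \<epsilon> (\<omega> j))
               (T\<^sub>h * real (b\<^sub>2 j)
                + T\<^sub>h * real (b\<^sub>2 j) powr (3/4)
                    * (sqrt L\<^sub>1 / max \<epsilon>\<^sub>2 (norm (stoch_grad A j x (\<omega> j)) powr \<alpha>) powr (1/2))
                + real (b\<^sub>1 j) * T\<^sub>g)))
     \<and>
     (measure (run_space D R) {\<omega> \<in> space (run_space D R).
          terminates (sncg2_stops A \<omega>) \<and>
          real (card (sncg2_sg_steps A \<omega>)) \<le> 8 * L\<^sub>1 / \<epsilon>\<^sub>1\<^sup>2 * \<Delta> \<and>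
          real (card (sncg2_ncg_steps A \<omega>)) \<le> 1 + 48 * L\<^sub>2\<^sup>2 / \<epsilon>\<^sub>2 ^ 3 * \<Delta>} \<ge> 1 - \<delta> \<and>
        (\<forall>\<omega>\<in>space (run_space D R). \<forall>j\<in>sncg2_ncg_steps A \<omega>.
          soft_O_bound (2 * C + 1) k CARD('n) \<delta>' (\<epsilon>\<^sub>2 / 2)
            (ncg_s_time T\<^sub>g T\<^sub>h pca_time A j (sncg2_iter A \<omega> j) (\<epsilon>\<^sub>2 / 2) (\<omega> j))
            (T\<^sub>h * real (b\<^sub>2 j)
             + T\<^sub>h * real (b\<^sub>2 j) powr (3/4) * (sqrt L\<^sub>1 / \<epsilon>\<^sub>2 powr (1/2))
             + real (b\<^sub>1 j) * T\<^sub>g)))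
     \<and>
     ((\<forall>\<alpha>. 0 < \<alpha> \<and> \<alpha> \<le> 1 \<and> \<epsilon>\<^sub>2 = \<epsilon>\<^sub>1 powr \<alpha> \<longrightarrow>
        measure (run_space D R) {\<omega> \<in> space (run_space D R).
          terminates (sncg1_stops A \<alpha> \<omega>) \<and>
          (let x = sncg1_iter A \<alpha> \<omega> (stop_index (sncg1_stops A \<alpha> \<omega>))
           in norm (gradient f x) \<le> 2 * \<epsilon>\<^sub>1 \<and> lambda_min (hessian f x) \<ge> - 2 * \<epsilon>\<^sub>2)}
          \<ge> 1 - 3 * \<delta>) \<and>
      measure (run_space D R) {\<omega> \<in> space (run_space D R).
          terminates (sncg2_stops A \<omega>) \<and>
          (let x = sncg2_iter A \<omega> (stop_index (sncg2_stops A \<omega>))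
           in norm (gradient f x) \<le> 2 * \<epsilon>\<^sub>1 \<and> lambda_min (hessian f x) \<ge> - 2 * \<epsilon>\<^sub>2)}
          \<ge> 1 - 3 * \<delta>)"
proof -
  have \<Delta>: "\<Delta> \<ge> 0" using assm_iii(1)[of x\<^sub>0] assm_iii(2) by linarith
  define M where "M = max (48 * L\<^sub>2\<^sup>2 / \<epsilon>\<^sub>2 ^ 3) (8 * L\<^sub>1 / \<epsilon>\<^sub>1\<^sup>2)"
  have "M > 0" using pos by (simp add: M_def max_def)
  then have "0 \<le> M * \<Delta>" using \<Delta> by simp
  moreover have "\<delta>' = \<delta> / (1 + M * \<Delta>)" by (simp add: \<delta>'_def M_def)
  ultimately have \<delta>': "0 < \<delta>'" "\<delta>' < 1" using \<delta> by simp_all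
  \<comment> \<open>The lower bound on the batch is positive because the argument of its logarithm
    exceeds 1, \<open>\<delta>'\<close> being less than 1.\<close>
  have b\<^sub>2_pos: "b\<^sub>2 j > 0" if "j \<ge> 1" for j
  proof -
    have "1 \<le> real CARD('n)" by (simp add: Suc_le_eq)
    then have "\<delta>' < 2 * real CARD('n)" using \<delta>' by linarith
    then have "1 < 2 * real CARD('n) / \<delta>'" using \<delta>' by simp
    then have "0 < 16 * L\<^sub>1\<^sup>2 / \<epsilon>\<^sub>3\<^sup>2 * ln (2 * real CARD('n) / \<delta>')"
      using pos by (intro mult_pos_pos ln_gt_zero) simp_all
    then show ?thesis using batch\<^sub>2[OF that] by linarith
  qed
  interpret sncg_problem D R F f x\<^sub>0 x_star L\<^sub>1 L\<^sub>2 \<Delta> \<epsilon>\<^sub>1 \<epsilon>\<^sub>2 \<epsilon>\<^sub>3 \<epsilon>\<^sub>4 \<delta> \<delta>' T\<^sub>g T\<^sub>h C k b\<^sub>1 b\<^sub>2 pca pca_time A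
    by (rule sncg_problem.intro[OF assms(1,2) f_def pos(1,2,4,5) cost_pos \<delta> assm_i assm_ii assm_iii
          \<epsilon>\<^sub>3_le \<epsilon>\<^sub>4_le \<delta>'_def A_def b\<^sub>2_pos accurate approx_pca])
  show ?thesis
    using prob_sncg1_steps sncg1_time prob_sncg2_steps sncg2_time prob_sncg1_output prob_sncg2_output
    unfolding Let_def K_def by blast
qed

end
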